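(* Let $H_1,H_2$ be closed subgroups of $\Omega_\infty$, each of index at most $2$. Then $H_1$ and $H_2$ are isomorphic as topological groups if and only if $H_1=H_2$.
   Context: $\Omega_\infty$ is the profinite group of graph automorphisms of the infinite, rooted, regular binary tree $T_\infty$ (the Cayley graph of the free monoid on $\{x,y\}$, where each word $w$ is joined to $xw$ and $yw$), with the topology of the inverse limit of its images in the automorphism groups of the finite truncations of the tree. *)

theory Defs
  imports "HOL-Algebra.Coset" "HOL-Analysis.Function_Topology"
begin

text \<open>Vertices of the infinite rooted binary tree are the words over a two-letter alphabet,
  represented by \<^typ>\<open>bool list\<close>; the root is the empty word, and a word \<open>w\<close> is joined to
  \<open>a # w\<close> for each letter \<open>a\<close>.\<close>

definition tree_adj :: "bool list \<Rightarrow> bool list \<Rightarrow> bool" where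
  "tree_adj u v \<longleftrightarrow> (\<exists>a. v = a # u \<or> u = a # v)"

definition tree_auts :: "(bool list \<Rightarrow> bool list) set" where
  "tree_auts = {g. bij g \<and> g [] = [] \<and> (\<forall>u v. tree_adj (g u) (g v) \<longleftrightarrow> tree_adj u v)}"

definition Omega :: "(bool list \<Rightarrow> bool list) monoid" where
  "Omega = \<lparr>carrier = tree_auts, mult = (\<circ>), one = id\<rparr>"

definition trunc_tree :: "nat \<Rightarrow> bool list set" where
  "trunc_tree n = {w. length w \<le> n}"

definition trunc_aut :: "nat \<Rightarrow> (bool list \<Rightarrow> bool list) \<Rightarrow> (bool list \<Rightarrow> bool list)" where
  "trunc_aut n g = restrict g (trunc_tree n)"

text \<open>The inverse limit topology: an automorphism is identified with the sequence of its
  restrictions to the finite truncations, a point of the product of the discrete spaces of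
  such restrictions.\<close>

definition Omega_top :: "(bool list \<Rightarrow> bool list) topology" where
  "Omega_top = pullback_topology (carrier Omega) (\<lambda>g n. trunc_aut n g)
     (product_topology (\<lambda>n. discrete_topology (trunc_aut n ` carrier Omega)) UNIV)"

text \<open>Finiteness is required separately because \<^const>\<open>card\<close> is \<open>0\<close> on infinite sets.\<close>

definition index_at_most :: "('a, 'b) monoid_scheme \<Rightarrow> 'a set \<Rightarrow> nat \<Rightarrow> bool" where
  "index_at_most G H k \<longleftrightarrow> finite (rcosets\<^bsub>G\<^esub> H) \<and> card (rcosets\<^bsub>G\<^esub> H) \<le> k"

definition top_group_isomorphic ::
    "('a, 'c) monoid_scheme \<Rightarrow> 'a topology \<Rightarrow> ('b, 'd) monoid_scheme \<Rightarrow> 'b topology \<Rightarrow> bool" where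
  "top_group_isomorphic G S H T \<longleftrightarrow> (\<exists>\<phi> \<in> iso G H. homeomorphic_map S T \<phi>)"

lemma group_Omega: "group Omega"
proof (rule groupI)
  fix g assume "g \<in> carrier Omega"
  then have g: "bij g" "g [] = []" "\<And>u v. tree_adj (g u) (g v) \<longleftrightarrow> tree_adj u v"
    by (auto simp: Omega_def tree_auts_def)
  have gi: "g (inv_into UNIV g u) = u" for u
    using g(1) by (simp add: bij_is_surj surj_f_inv_f)
  have "inv_into UNIV g \<in> carrier Omega"
    using g(1) g(2) g(3)[of "inv_into UNIV g _" "inv_into UNIV g _"]
    by (auto simp: Omega_def tree_auts_def gi bij_imp_bij_inv intro: inv_f_eq bij_is_inj)
  moreover have "inv_into UNIV g \<otimes>\<^bsub>Omega\<^esub> g = \<one>\<^bsub>Omega\<^esub>"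
    using g(1) by (simp add: Omega_def bij_is_inj)
  ultimately show "\<exists>h \<in> carrier Omega. h \<otimes>\<^bsub>Omega\<^esub> g = \<one>\<^bsub>Omega\<^esub>" by blast
qed (auto simp: Omega_def tree_auts_def bij_comp comp_assoc)

lemma topspace_Omega_top: "topspace Omega_top = carrier Omega"
  by (auto simp: Omega_top_def topspace_pullback_topology)

end

theory Submission
  imports Defs "HOL-Library.Sublist"
begin

text \<open>Recording at which vertices an automorphism flips the two children, the parity of the number
  of flips on level \<open>k\<close> is a homomorphism to the group of order two. The closed subgroups of index
  at most two are the kernels \<open>H\<^sub>S\<close> of the finite products of these signs over levels \<open>k \<in> S\<close>.
  It remains to recover \<open>S\<close> from the abstract group \<open>H\<^sub>S\<close>.

  Consider pairs \<open>A, B\<close> of nontrivial subgroups that are each other's centralizer and such that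
  every element of \<open>H\<^sub>S\<close> normalises both or interchanges them. A commutator argument shows that no
  vertex is moved by both \<open>A\<close> and \<open>B\<close>. The elements supported on the left and on the right half
  of the tree form such a pair, and unless \<open>S\<close> is \<open>{0}\<close> or \<open>{1}\<close> it is the only one, since
  the action on a level then has only one system of two blocks. So an isomorphism
  \<open>H\<^sub>S \<cong> H\<^sub>T\<close> matches the halves, and these are isomorphic to \<open>H\<close> of the shifted sets
  \<open>{k. Suc k \<in> S}\<close> and \<open>{k. Suc k \<in> T}\<close>, which are equal by induction. Finally \<open>0 \<notin> S\<close> iff some
  involution in \<open>H\<^sub>S\<close> interchanges the halves. The case \<open>S = {0}\<close> is singled out by a pair as above
  that is normal in the whole group; the case \<open>S = {1}\<close> needs no separate treatment, because the
  uniqueness is only used for one of the two groups.\<close>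

section \<open>Portraits\<close>

text \<open>Words grow at the head, so ancestors are suffixes, and \<open>p w\<close> decides
  whether the children of the source vertex \<open>w\<close> exchange their letters.\<close>

primrec aut :: "(bool list \<Rightarrow> bool) \<Rightarrow> bool list \<Rightarrow> bool list" where
  "aut p [] = []"
| "aut p (a # w) = (a \<noteq> p w) # aut p w"

text \<open>For an automorphism, testing the child \<open>True # w\<close> suffices: by injectivity
  the other child receives the other letter.\<close>

definition flips :: "(bool list \<Rightarrow> bool list) \<Rightarrow> bool list \<Rightarrow> bool" where
  "flips g w \<longleftrightarrow> \<not> hd (g (True # w))"

lemma flips_aut [simp]: "flips (aut p) = p"
  by (auto simp: flips_def)

lemma length_aut [simp]: "length (aut p w) = length w"
  by (induction w) auto

lemma inj_aut: "inj (aut p)"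
proof (rule injI)
  show "aut p v = aut p w \<Longrightarrow> v = w" for v w
  proof (induction v arbitrary: w)
    case Nil
    then show ?case by (cases w) auto
  next
    case (Cons a v)
    then show ?case by (cases w) auto
  qed
qed

lemma surj_aut: "surj (aut p)"
proof -
  have "\<exists>w. v = aut p w" for v
  proof (induction v)
    case Nil
    have "[] = aut p []" by simp
    then show ?case by blast
  next
    case (Cons b v)
    then obtain w where "v = aut p w" by blast
    then have "b # v = aut p ((b \<noteq> p w) # w)" by auto
    then show ?case by blast
  qed
  then show ?thesis by (auto simp: surj_def)
qed

lemma tree_adj_aut: "tree_adj (aut p u) (aut p v) \<longleftrightarrow> tree_adj u v"
proof -
  have "(\<exists>a. aut p y = a # aut p x) \<longleftrightarrow> (\<exists>a. y = a # x)" for x y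
    by (cases y) (auto dest: injD[OF inj_aut])
  then show ?thesis unfolding tree_adj_def by metis
qed

lemma aut_in_tree_auts [simp]: "aut p \<in> tree_auts"
  by (simp add: tree_auts_def bij_def inj_aut surj_aut tree_adj_aut)

text \<open>Adjacency puts the image of a child directly below or directly above the image of its
  parent. In the latter case it would equal the image of the grandparent, against
  injectivity.\<close>

lemma tree_auts_Cons_ex:
  assumes "g \<in> tree_auts"
  shows "\<exists>b. g (a # w) = b # g w"
proof (induction w arbitrary: a)
  case Nil
  have "tree_adj [a] []" by (simp add: tree_adj_def)
  moreover have "tree_adj (g [a]) (g []) \<longleftrightarrow> tree_adj [a] []"
    using assms unfolding tree_auts_def by blast
  moreover have "g [] = []" using assms by (simp add: tree_auts_def)
  ultimately show ?case by (auto simp: tree_adj_def)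
next
  case (Cons c w)
  have "tree_adj (c # w) (a # c # w)" by (simp add: tree_adj_def)
  then have "tree_adj (g (c # w)) (g (a # c # w))" using assms by (simp add: tree_auts_def)
  then consider b where "g (a # c # w) = b # g (c # w)" | b where "g (c # w) = b # g (a # c # w)"
    by (auto simp: tree_adj_def)
  then show ?case
  proof cases
    case 2
    obtain c' where "g (c # w) = c' # g w" using Cons.IH by blast
    with 2 have "g (a # c # w) = g w" by simp
    then have "a # c # w = w" using assms by (auto simp: tree_auts_def bij_def dest: injD)
    then have "length (a # c # w) = length w" by (rule arg_cong)
    then show ?thesis by simp
  qed blast
qed

lemma tree_auts_Cons:
  assumes "g \<in> tree_auts"
  shows "g (a # w) = (a \<noteq> flips g w) # g w"
proof -
  obtain b c where b: "g (True # w) = b # g w" and c: "g (False # w) = c # g w"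
    using tree_auts_Cons_ex[OF assms] by blast
  have "g (True # w) \<noteq> g (False # w)"
    using assms by (auto simp: tree_auts_def bij_def dest: injD)
  with b c show ?thesis by (cases a) (auto simp: flips_def)
qed

lemma aut_flips: "g \<in> tree_auts \<Longrightarrow> aut (flips g) = g"
proof
  show "g \<in> tree_auts \<Longrightarrow> aut (flips g) w = g w" for w
    by (induction w) (auto simp: tree_auts_Cons, simp add: tree_auts_def)
qed

lemma tree_autsE:
  assumes "g \<in> tree_auts"
  obtains p where "g = aut p"
  using aut_flips[OF assms] by metis

lemma tree_auts_bij: "g \<in> tree_auts \<Longrightarrow> bij g"
  by (simp add: tree_auts_def)

lemma tree_auts_eq_iff: "g \<in> tree_auts \<Longrightarrow> g v = g w \<longleftrightarrow> v = w"
  by (meson bij_is_inj inj_eq tree_auts_bij)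

lemma length_tree_auts [simp]: "g \<in> tree_auts \<Longrightarrow> length (g w) = length w"
  by (metis tree_autsE length_aut)

lemma id_tree_auts [simp]: "id \<in> tree_auts"
  by (simp add: tree_auts_def)

lemma comp_tree_auts [simp]: "g \<in> tree_auts \<Longrightarrow> h \<in> tree_auts \<Longrightarrow> g \<circ> h \<in> tree_auts"
  by (auto simp: tree_auts_def bij_comp)

abbreviation finv :: "('a \<Rightarrow> 'b) \<Rightarrow> 'b \<Rightarrow> 'a" where
  "finv g \<equiv> inv_into UNIV g"

lemma inv_tree_auts [simp]:
  assumes "g \<in> tree_auts"
  shows "finv g \<in> tree_auts"
proof -
  have "bij g" using assms by (rule tree_auts_bij)
  then have gi: "g (finv g u) = u" for u by (simp add: bij_is_surj surj_f_inv_f)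
  have "tree_adj (g u) (g v) \<longleftrightarrow> tree_adj u v" for u v
    using assms by (simp add: tree_auts_def)
  from this[of "finv g _" "finv g _"] have "tree_adj (finv g u) (finv g v) \<longleftrightarrow> tree_adj u v" for u v
    by (simp add: gi)
  moreover have "finv g [] = []"
    by (rule inv_f_eq) (use assms \<open>bij g\<close> in \<open>auto simp: tree_auts_def bij_is_inj\<close>)
  ultimately show ?thesis
    using \<open>bij g\<close> by (simp add: tree_auts_def bij_imp_bij_inv)
qed

lemma tree_auts_Nil [simp]: "g \<in> tree_auts \<Longrightarrow> g [] = []"
  by (simp add: tree_auts_def)

lemma inv_tree_auts_simps [simp]:
  assumes "g \<in> tree_auts"
  shows "finv g (g w) = w" "g (finv g w) = w" "finv g \<circ> g = id" "g \<circ> finv g = id"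
  using tree_auts_bij[OF assms] by (auto simp: bij_def surj_f_inv_f)

lemma flips_id [simp]: "flips id w = False"
  by (simp add: flips_def)

lemma flips_comp:
  assumes "g \<in> tree_auts" "h \<in> tree_auts"
  shows "flips (g \<circ> h) w \<longleftrightarrow> flips h w \<noteq> flips g (h w)"
  unfolding flips_def[of "g \<circ> h"] using assms by (auto simp: tree_auts_Cons)

lemma tree_auts_append:
  assumes "g \<in> tree_auts"
  shows "\<exists>u'. length u' = length u \<and> g (u @ v) = u' @ g v"
proof (induction u)
  case (Cons a u)
  then obtain u' where "length u' = length u" "g (u @ v) = u' @ g v" by blast
  then have "length ((a \<noteq> flips g (u @ v)) # u') = length (a # u)
      \<and> g ((a # u) @ v) = ((a \<noteq> flips g (u @ v)) # u') @ g v"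
    using tree_auts_Cons[OF assms] by simp
  then show ?case by blast
qed simp

lemma suffix_tree_auts:
  assumes "g \<in> tree_auts"
  shows "suffix (g v) (g w) \<longleftrightarrow> suffix v w"
proof
  assume "suffix v w"
  then show "suffix (g v) (g w)"
    using tree_auts_append[OF assms] by (metis suffix_def)
next
  assume "suffix (g v) (g w)"
  then obtain u where u: "g w = u @ g v" by (auto simp: suffix_def)
  obtain u' where "finv g (u @ g v) = u' @ finv g (g v)"
    using tree_auts_append[OF inv_tree_auts[OF assms]] by blast
  then show "suffix v w" using assms u by (metis inv_tree_auts_simps(1) suffix_def)
qed

text \<open>Mostly used in contrapositive form: all descendants of a moved vertex are moved, so a
  moved vertex may be replaced by one as deep as desired.\<close>

lemma tree_auts_fixes_append:
  assumes "g \<in> tree_auts" "g (u @ v) = u @ v"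
  shows "g v = v"
  using tree_auts_append[OF assms(1), of u v] assms(2) by (auto simp: append_eq_append_conv)

lemma aut_fixes:
  "(\<And>u. strict_suffix u v \<Longrightarrow> \<not> p u) \<Longrightarrow> aut p v = v"
proof (induction v)
  case (Cons a v)
  have "strict_suffix v (a # v)" by (simp add: strict_suffix_def suffix_def)
  moreover have "strict_suffix u (a # v)" if "strict_suffix u v" for u
    using that by (auto simp: strict_suffix_def suffix_def)
  ultimately show ?case using Cons by auto
qed simp

section \<open>Elementary swaps and level signs\<close>

definition swap_at :: "bool list \<Rightarrow> bool list \<Rightarrow> bool list" where
  "swap_at u = aut (\<lambda>w. w = u)"

lemma swap_at_tree_auts [simp]: "swap_at u \<in> tree_auts"
  by (simp add: swap_at_def)

lemma flips_swap_at [simp]: "flips (swap_at u) w \<longleftrightarrow> w = u"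
  by (simp add: swap_at_def)

lemma swap_at_fixes: "\<not> strict_suffix u v \<Longrightarrow> swap_at u v = v"
  unfolding swap_at_def by (rule aut_fixes) auto

lemma swap_at_fixes_length: "length v \<le> length u \<Longrightarrow> swap_at u v = v"
  by (rule swap_at_fixes) (auto simp: strict_suffix_def suffix_def)

lemma swap_at_Cons [simp]: "swap_at u (c # u) = (\<not> c) # u"
  using tree_auts_Cons[of "swap_at u" c u] by (simp add: swap_at_fixes_length)

lemma tree_auts_eqI:
  assumes "g \<in> tree_auts" "h \<in> tree_auts" "\<And>w. flips g w = flips h w"
  shows "g = h"
proof -
  have "flips g = flips h" using assms(3) by blast
  then show ?thesis using assms(1,2) aut_flips by metis
qed

text \<open>The side condition is needed: in general \<open>g \<circ> swap_at u \<circ> finv g\<close> differs from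
  \<open>swap_at (g u)\<close> by the different actions of \<open>g\<close> below the two children of \<open>u\<close>.\<close>

lemma swap_at_conj:
  assumes "g \<in> tree_auts" and below: "\<And>x. flips g x \<Longrightarrow> length x < length u"
  shows "g \<circ> swap_at u = swap_at (g u) \<circ> g"
proof (rule tree_auts_eqI)
  fix w
  have "flips g (swap_at u w) = flips g w"
  proof (cases "length w \<le> length u")
    case False
    then show ?thesis using below[of w] below[of "swap_at u w"] by auto
  qed (simp add: swap_at_fixes_length)
  then show "flips (g \<circ> swap_at u) w = flips (swap_at (g u) \<circ> g) w"
    using assms(1) by (auto simp: flips_comp tree_auts_eq_iff)
qed (use assms in auto)

text \<open>The bound on the flips is what \<open>swap_at_conj\<close> requires. The witness is
  built from the root downwards, with one further swap whenever the new letters differ.\<close>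

lemma tree_auts_transitive:
  assumes "length u = length v"
  obtains g where "g \<in> tree_auts" "g u = v" "\<And>x. flips g x \<Longrightarrow> length x < length u"
proof -
  have "\<exists>g \<in> tree_auts. g u = v \<and> (\<forall>x. flips g x \<longrightarrow> length x < length u)"
    using assms
  proof (induction u v rule: list_induct2)
    case Nil
    show ?case by (rule bexI[of _ id]) (auto simp: flips_def)
  next
    case (Cons a u b v)
    then obtain g where g: "g \<in> tree_auts" "g u = v" "\<And>x. flips g x \<Longrightarrow> length x < length u"
      by blast
    have "\<not> flips g u" using g(3)[of u] by auto
    with g have gu: "g (c # u) = c # v" for c by (simp add: tree_auts_Cons)
    show ?case
    proof (cases "a = b")
      case True
      then show ?thesis using g gu by (intro bexI[of _ g]) (auto intro: less_SucI)
    next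
      case False
      moreover have "length x < Suc (length u)" if "flips (g \<circ> swap_at u) x" for x
        using that g(1) g(3)[of "swap_at u x"] by (auto simp: flips_comp split: if_splits)
      moreover have "(g \<circ> swap_at u) (a # u) = b # v"
        using gu False by simp
      moreover have "g \<circ> swap_at u \<in> tree_auts" using g(1) by simp
      ultimately show ?thesis unfolding length_Cons by blast
    qed
  qed
  then show thesis using that by blast
qed

section \<open>Signs of sets of levels and their kernels\<close>

definition act_sign :: "(bool list \<Rightarrow> bool list) \<Rightarrow> bool list \<Rightarrow> int" where
  "act_sign g w = (if flips g w then -1 else 1)"

text \<open>For infinite \<open>S\<close> the product takes its default value 1, and the kernel is
  everything; finiteness of \<open>S\<close> is therefore assumed where signs of particular elements
  are computed.\<close>

definition level_sign :: "nat set \<Rightarrow> (bool list \<Rightarrow> bool list) \<Rightarrow> int" where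
  "level_sign S g = (\<Prod>w | length w \<in> S. act_sign g w)"

definition sign_kernel :: "nat set \<Rightarrow> (bool list \<Rightarrow> bool list) set" where
  "sign_kernel S = {g \<in> tree_auts. level_sign S g = 1}"

lemma finite_level_words:
  assumes "finite S"
  shows "finite {w :: bool list. length w \<in> S}"
proof -
  have "{w :: bool list. length w \<in> S} = (\<Union>k\<in>S. {w. set w \<subseteq> UNIV \<and> length w = k})"
    by auto
  then show ?thesis using assms finite_lists_length_eq[of "UNIV :: bool set"] by simp
qed

lemma act_sign_comp:
  "g \<in> tree_auts \<Longrightarrow> h \<in> tree_auts \<Longrightarrow> act_sign (g \<circ> h) w = act_sign h w * act_sign g (h w)"
  by (auto simp: act_sign_def flips_comp)

text \<open>The cocycle rule for flips becomes multiplicativity because \<open>h\<close> permutes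
  the vertices of each level.\<close>

lemma level_sign_comp:
  assumes "g \<in> tree_auts" "h \<in> tree_auts"
  shows "level_sign S (g \<circ> h) = level_sign S g * level_sign S h"
proof -
  have "bij_betw h {w. length w \<in> S} {w. length w \<in> S}"
    by (rule bij_betwI[where g = "finv h"]) (use assms in auto)
  then have "(\<Prod>w | length w \<in> S. act_sign g (h w)) = level_sign S g"
    unfolding level_sign_def by (rule prod.reindex_bij_betw)
  then show ?thesis
    using assms by (simp add: level_sign_def act_sign_comp prod.distrib mult.commute)
qed

lemma level_sign_id [simp]: "level_sign S id = 1"
  by (simp add: level_sign_def act_sign_def)

lemma level_sign_cases: "level_sign S g = 1 \<or> level_sign S g = -1"
proof -
  have "level_sign S g * level_sign S g = 1"
    unfolding level_sign_def prod.distrib[symmetric] by (rule prod.neutral) (simp add: act_sign_def)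
  then show ?thesis by (simp add: square_eq_1_iff)
qed

lemma level_sign_swap_at:
  assumes "finite S"
  shows "level_sign S (swap_at u) = (if length u \<in> S then -1 else 1)"
proof -
  have "level_sign S (swap_at u) = (\<Prod>w | length w \<in> S. if w = u then -1 else 1)"
    by (simp add: level_sign_def act_sign_def)
  then show ?thesis using finite_level_words[OF assms] by (simp add: prod.delta)
qed

lemma sign_kernel_tree_auts: "g \<in> sign_kernel S \<Longrightarrow> g \<in> tree_auts"
  by (simp add: sign_kernel_def)

lemma id_sign_kernel [simp]: "id \<in> sign_kernel S"
  by (simp add: sign_kernel_def)

lemma comp_sign_kernel [simp]: "g \<in> sign_kernel S \<Longrightarrow> h \<in> sign_kernel S \<Longrightarrow> g \<circ> h \<in> sign_kernel S"
  by (simp add: sign_kernel_def level_sign_comp)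

lemma inv_sign_kernel [simp]:
  assumes "g \<in> sign_kernel S"
  shows "finv g \<in> sign_kernel S"
proof -
  have g: "g \<in> tree_auts" "level_sign S g = 1" using assms by (auto simp: sign_kernel_def)
  then have "level_sign S (finv g \<circ> g) = level_sign S (finv g) * level_sign S g"
    by (intro level_sign_comp) auto
  then show ?thesis using g by (simp add: sign_kernel_def)
qed

text \<open>A wrong sign is corrected by a swap on a nonzero level of \<open>S\<close> that fixes
  \<open>v\<close>. For \<open>S = {0}\<close> the kernel does not exchange the two children of the
  root.\<close>

lemma sign_kernel_transitive:
  assumes "finite S" "S \<noteq> {0}" "length v = length w"
  obtains h where "h \<in> sign_kernel S" "h v = w"
proof -
  obtain g where g: "g \<in> tree_auts" "g v = w" using tree_auts_transitive[OF assms(3)] by metis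
  consider "v = []" | "level_sign S g = 1" | "v \<noteq> []" "level_sign S g = -1"
    using level_sign_cases by blast
  then show thesis
  proof cases
    case 1
    then show thesis using that[of id] assms(3) by simp
  next
    case 2
    then show thesis using that[of g] g by (simp add: sign_kernel_def)
  next
    case 3
    then have "S \<noteq> {}" by (auto simp: level_sign_def)
    then have "\<not> S \<subseteq> {0}" using assms(2) by (simp add: subset_singleton_iff)
    then obtain m where m: "m \<in> S" "m \<noteq> 0" by blast
    \<comment> \<open>The last letter is the first step from the root, so \<open>z\<close> lies in
      the half not containing \<open>v\<close> and is no ancestor of \<open>v\<close>.\<close>
    define z where "z = replicate m (\<not> last v)"
    have "\<not> strict_suffix z v"
    proof
      assume "strict_suffix z v"
      then obtain y where "v = y @ z" by (auto simp: strict_suffix_def suffix_def)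
      then have "last v = last z" using m(2) by (metis last_appendR length_0_conv length_replicate z_def)
      moreover have "last z = (\<not> last v)" using m(2) by (simp add: z_def)
      ultimately show False by blast
    qed
    then have "(g \<circ> swap_at z) v = w" using g by (simp add: swap_at_fixes)
    moreover have "g \<circ> swap_at z \<in> sign_kernel S"
      using g 3 m assms(1) by (simp add: sign_kernel_def level_sign_comp level_sign_swap_at z_def)
    ultimately show thesis using that by blast
  qed
qed

section \<open>Grafting\<close>

text \<open>A copy of \<open>g\<close> on the subtree rooted at \<open>w\<close>, whose vertices are
  the words \<open>u @ w\<close>; \<open>take\<close> recovers \<open>u\<close>.\<close>

definition graft :: "bool list \<Rightarrow> (bool list \<Rightarrow> bool list) \<Rightarrow> bool list \<Rightarrow> bool list" where
  "graft w g x = (if suffix w x then g (take (length x - length w) x) @ w else x)"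

lemma suffix_append_self [simp]: "suffix w (u @ w)"
  by (simp add: suffix_def)

lemma graft_append [simp]: "graft w g (u @ w) = g u @ w"
  by (simp add: graft_def)

lemma graft_outside: "\<not> suffix w x \<Longrightarrow> graft w g x = x"
  by (simp add: graft_def)

lemma graft_comp: "graft w (g \<circ> h) = graft w g \<circ> graft w h"
proof
  show "graft w (g \<circ> h) x = (graft w g \<circ> graft w h) x" for x
    by (cases "suffix w x") (auto simp: suffix_def graft_outside)
qed

lemma graft_id [simp]: "graft w id = id"
proof
  show "graft w id x = id x" for x
    by (cases "suffix w x") (auto simp: suffix_def graft_outside)
qed

lemma graft_eq_iff: "graft w g = graft w h \<longleftrightarrow> g = h"
proof
  assume eq: "graft w g = graft w h"
  show "g = h"
  proof
    show "g u = h u" for u using fun_cong[OF eq, of "u @ w"] by simp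
  qed
qed simp

lemma graft_Cons:
  assumes "g \<in> tree_auts"
  shows "graft w g (a # x) = (a \<noteq> (suffix w x \<and> flips g (take (length x - length w) x))) # graft w g x"
proof (cases "suffix w x")
  case True
  then obtain u where u: "x = u @ w" by (auto simp: suffix_def)
  show ?thesis
    using graft_append[of w g "a # u"] assms by (simp add: u tree_auts_Cons)
next
  case False
  show ?thesis
  \<comment> \<open>The root \<open>w\<close> of the copy has suffix \<open>w\<close> although its
    parent does not; it stays fixed because \<open>g [] = []\<close>.\<close>
  proof (cases "a # x = w")
    case True
    then show ?thesis using False assms graft_append[of w g "[]"] by (simp add: graft_outside)
  next
    case neq: False
    then have "\<not> suffix w (a # x)" using False by (auto simp: suffix_Cons)
    then show ?thesis using False by (simp add: graft_outside)
  qed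
qed

lemma graft_eq_aut:
  assumes "g \<in> tree_auts"
  shows "graft w g = aut (\<lambda>x. suffix w x \<and> flips g (take (length x - length w) x))"
proof
  fix x
  show "graft w g x = aut (\<lambda>x. suffix w x \<and> flips g (take (length x - length w) x)) x"
    using assms by (induction x) (simp_all add: graft_Cons, simp add: graft_def)
qed

lemma graft_tree_auts [simp]: "g \<in> tree_auts \<Longrightarrow> graft w g \<in> tree_auts"
  by (simp add: graft_eq_aut)

text \<open>The flips of the graft are those of \<open>g\<close>, moved down by
  \<open>length w\<close> levels; all other vertices contribute the factor 1.\<close>

lemma level_sign_graft:
  assumes "finite S" "g \<in> tree_auts"
  shows "level_sign S (graft w g) = level_sign {k. k + length w \<in> S} g"
proof -
  have "level_sign S (graft w g) = (\<Prod>x \<in> (\<lambda>u. u @ w) ` {u. length u + length w \<in> S}. act_sign (graft w g) x)"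
    unfolding level_sign_def
  proof (rule prod.mono_neutral_right)
    show "finite {x :: bool list. length x \<in> S}" using assms(1) by (rule finite_level_words)
    show "\<forall>x\<in>{x. length x \<in> S} - (\<lambda>u. u @ w) ` {u. length u + length w \<in> S}. act_sign (graft w g) x = 1"
      using assms(2) by (auto simp: act_sign_def graft_eq_aut suffix_def)
  qed auto
  also have "\<dots> = (\<Prod>u | length u + length w \<in> S. act_sign (graft w g) (u @ w))"
    by (simp add: prod.reindex inj_on_def)
  also have "\<dots> = level_sign {k. k + length w \<in> S} g"
    using assms(2) by (simp add: level_sign_def act_sign_def graft_eq_aut)
  finally show ?thesis .
qed

section \<open>Mutually centralizing pairs\<close>

definition cent :: "('a \<Rightarrow> 'a) set \<Rightarrow> ('a \<Rightarrow> 'a) set \<Rightarrow> ('a \<Rightarrow> 'a) set" where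
  "cent G A = {g \<in> G. \<forall>a\<in>A. g \<circ> a = a \<circ> g}"

text \<open>The relation \<open>h A = B h\<close> expresses \<open>h A h\<^sup>-\<^sup>1 = B\<close> without inverses, so that it is
  visibly preserved by multiplicative bijections.\<close>

definition conjugates :: "('a \<Rightarrow> 'a) \<Rightarrow> ('a \<Rightarrow> 'a) set \<Rightarrow> ('a \<Rightarrow> 'a) set \<Rightarrow> bool" where
  "conjugates h A B \<longleftrightarrow> (\<lambda>a. h \<circ> a) ` A = (\<lambda>b. b \<circ> h) ` B"

definition centralizing_pair :: "('a \<Rightarrow> 'a) set \<Rightarrow> ('a \<Rightarrow> 'a) set \<Rightarrow> ('a \<Rightarrow> 'a) set \<Rightarrow> bool" where
  "centralizing_pair G A B \<longleftrightarrow> A = cent G B \<and> B = cent G A \<and> A \<noteq> {id} \<and> B \<noteq> {id}"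

definition permuted_pair :: "('a \<Rightarrow> 'a) set \<Rightarrow> ('a \<Rightarrow> 'a) set \<Rightarrow> ('a \<Rightarrow> 'a) set \<Rightarrow> bool" where
  "permuted_pair G A B \<longleftrightarrow> centralizing_pair G A B \<and>
     (\<forall>h\<in>G. conjugates h A A \<and> conjugates h B B \<or> conjugates h A B \<and> conjugates h B A)"

definition normal_pair :: "('a \<Rightarrow> 'a) set \<Rightarrow> ('a \<Rightarrow> 'a) set \<Rightarrow> ('a \<Rightarrow> 'a) set \<Rightarrow> bool" where
  "normal_pair G A B \<longleftrightarrow> centralizing_pair G A B \<and>
     (\<forall>h\<in>G. conjugates h A A \<and> conjugates h B B)"

definition moves :: "('a \<Rightarrow> 'a) set \<Rightarrow> 'a \<Rightarrow> bool" where
  "moves A v \<longleftrightarrow> (\<exists>a\<in>A. a v \<noteq> v)"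

lemma cent_subset: "cent G A \<subseteq> G"
  by (auto simp: cent_def)

lemma centralizing_pair_commute: "centralizing_pair G A B \<Longrightarrow> centralizing_pair G B A"
  unfolding centralizing_pair_def by blast

lemma conjugatesD: "conjugates h A B \<Longrightarrow> a \<in> A \<Longrightarrow> \<exists>b\<in>B. h \<circ> a = b \<circ> h"
  unfolding conjugates_def by (metis image_iff)

lemma conjugatesD2: "conjugates h A B \<Longrightarrow> b \<in> B \<Longrightarrow> \<exists>a\<in>A. h \<circ> a = b \<circ> h"
  unfolding conjugates_def by (metis image_iff)

lemma conjugatesI:
  assumes "\<And>a. a \<in> A \<Longrightarrow> \<exists>b\<in>B. h \<circ> a = b \<circ> h" "\<And>b. b \<in> B \<Longrightarrow> \<exists>a\<in>A. h \<circ> a = b \<circ> h"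
  shows "conjugates h A B"
  unfolding conjugates_def
proof (intro equalityI subsetI)
  show "x \<in> (\<lambda>b. b \<circ> h) ` B" if "x \<in> (\<lambda>a. h \<circ> a) ` A" for x
    using that assms(1) by (metis (no_types, lifting) image_iff)
  show "x \<in> (\<lambda>a. h \<circ> a) ` A" if "x \<in> (\<lambda>b. b \<circ> h) ` B" for x
    using that assms(2) by (metis (no_types, lifting) image_iff)
qed

lemma conjugates_comp:
  assumes "conjugates h A B" "conjugates k B C"
  shows "conjugates (k \<circ> h) A C"
proof (rule conjugatesI)
  fix a assume "a \<in> A"
  then obtain b where b: "b \<in> B" "h \<circ> a = b \<circ> h" using conjugatesD[OF assms(1)] by blast
  then obtain c where c: "c \<in> C" "k \<circ> b = c \<circ> k" using conjugatesD[OF assms(2)] by blast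
  have "k \<circ> h \<circ> a = c \<circ> (k \<circ> h)" by (metis b(2) c(2) comp_assoc)
  then show "\<exists>c\<in>C. k \<circ> h \<circ> a = c \<circ> (k \<circ> h)" using c(1) by blast
next
  fix c assume "c \<in> C"
  then obtain b where b: "b \<in> B" "k \<circ> b = c \<circ> k" using conjugatesD2[OF assms(2)] by blast
  then obtain a where a: "a \<in> A" "h \<circ> a = b \<circ> h" using conjugatesD2[OF assms(1)] by blast
  have "k \<circ> h \<circ> a = c \<circ> (k \<circ> h)" by (metis a(2) b(2) comp_assoc)
  then show "\<exists>a\<in>A. k \<circ> h \<circ> a = c \<circ> (k \<circ> h)" using a(1) by blast
qed

lemma conjugates_inj:
  fixes h :: "'a \<Rightarrow> 'a"
  assumes "surj h" "conjugates h A B" "conjugates h A C"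
  shows "B = C"
proof -
  have "inj (\<lambda>b :: 'a \<Rightarrow> 'a. b \<circ> h)" by (rule injI) (metis assms(1) surj_fun_eq)
  moreover have "(\<lambda>b. b \<circ> h) ` B = (\<lambda>b. b \<circ> h) ` C" using assms(2,3) by (simp add: conjugates_def)
  ultimately show ?thesis by (simp add: inj_image_eq_iff)
qed

text \<open>Two interchanges compose to a normalisation. This is why the commutator argument below
  works with squares.\<close>

lemma permuted_pair_square:
  assumes "permuted_pair G A B" "h \<in> G"
  shows "conjugates (h \<circ> h) A A" "conjugates (h \<circ> h) B B"
  using assms unfolding permuted_pair_def by (metis conjugates_comp)+

lemma conjugates_moves:
  assumes "conjugates h A B" "inj h"
  shows "moves B (h v) \<longleftrightarrow> moves A v"
proof
  assume "moves B (h v)"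
  then obtain b where b: "b \<in> B" "b (h v) \<noteq> h v" by (auto simp: moves_def)
  then obtain a where a: "a \<in> A" "h \<circ> a = b \<circ> h" using conjugatesD2[OF assms(1)] by blast
  have "h (a v) = b (h v)" using fun_cong[OF a(2)] by simp
  then show "moves A v" using a(1) b(2) unfolding moves_def by metis
next
  assume "moves A v"
  then obtain a where a: "a \<in> A" "a v \<noteq> v" by (auto simp: moves_def)
  then obtain b where b: "b \<in> B" "h \<circ> a = b \<circ> h" using conjugatesD[OF assms(1)] by blast
  have "h (a v) = b (h v)" using fun_cong[OF b(2)] by simp
  then show "moves B (h v)" using a(2) b(1) assms(2) by (metis injD moves_def)
qed

lemma moves_append:
  assumes "A \<subseteq> tree_auts" "moves A v"
  shows "moves A (u @ v)"
  using assms tree_auts_fixes_append unfolding moves_def by blast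

section \<open>Commutators of elements living below a vertex\<close>

lemma aut_involution:
  assumes "\<And>w. p (aut p w) = p w"
  shows "aut p \<circ> aut p = id"
  by (rule tree_auts_eqI) (auto simp: flips_comp assms)

text \<open>Squares are needed to normalise both members of a permuted pair; being involutions makes
  \<open>X \<circ> Y \<circ> X \<circ> Y\<close> their commutator.\<close>

lemma ex_noncommuting_squares:
  obtains x y X Y where "x \<in> tree_auts" "y \<in> tree_auts" "X = x \<circ> x" "Y = y \<circ> y"
    "X \<circ> X = id" "Y \<circ> Y = id" "X \<circ> Y \<circ> X \<circ> Y \<noteq> id"
proof
  \<comment> \<open>Squaring \<open>aut p\<close> leaves flips at both vertices of level one, and
    squaring \<open>aut q\<close> leaves flips at the two vertices of level two with head
    \<open>True\<close>. Conjugation by \<open>aut P\<close> carries the latter to the vertices with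
    head \<open>False\<close>, so the squares do not commute.\<close>
  define p where "p = (\<lambda>w. w = [] \<or> w = [True])"
  define q where "q = (\<lambda>w. w = [] \<or> w = [True, False])"
  define P where "P = (\<lambda>w :: bool list. length w = 1)"
  define Q where "Q = (\<lambda>w. w = [True, True] \<or> w = [True, False])"
  show "aut p \<in> tree_auts" "aut q \<in> tree_auts" by simp_all
  show "aut P = aut p \<circ> aut p"
  proof (rule tree_auts_eqI)
    fix w
    have "P w \<longleftrightarrow> p w \<noteq> p (aut p w)"
      by (cases w; cases "tl w") (auto simp: P_def p_def)
    then show "flips (aut P) w = flips (aut p \<circ> aut p) w" by (simp add: flips_comp)
  qed simp_all
  show "aut Q = aut q \<circ> aut q"
  proof (rule tree_auts_eqI)
    fix w
    have "Q w \<longleftrightarrow> q w \<noteq> q (aut q w)"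
      by (cases w; cases "tl w"; cases "tl (tl w)") (auto simp: Q_def q_def)
    then show "flips (aut Q) w = flips (aut q \<circ> aut q) w" by (simp add: flips_comp)
  qed simp_all
  show "aut P \<circ> aut P = id" by (rule aut_involution) (simp add: P_def)
  show "aut Q \<circ> aut Q = id"
  proof (rule aut_involution)
    show "Q (aut Q w) = Q w" for w
      by (cases w; cases "tl w"; cases "tl (tl w)") (auto simp: Q_def)
  qed
  have "(aut P \<circ> aut Q \<circ> aut P \<circ> aut Q) [True, True, True] \<noteq> [True, True, True]"
    by (simp add: P_def Q_def)
  then show "aut P \<circ> aut Q \<circ> aut P \<circ> aut Q \<noteq> id" by (metis id_apply)
qed

lemma suffix_graft: "suffix w (graft w f x) \<longleftrightarrow> suffix w x"
  by (cases "suffix w x") (auto simp: graft_def)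

lemma suffix_same_length: "suffix v x \<Longrightarrow> suffix w x \<Longrightarrow> length v = length w \<Longrightarrow> v = w"
  by (auto simp: suffix_def append_eq_append_conv)

text \<open>The conjugate by \<open>a\<close> lives below \<open>a w\<close>. This vertex differs
  from \<open>w\<close> but has the same level, so the two subtrees are disjoint.\<close>

lemma graft_commutes_with_conjugate:
  assumes a: "a \<in> tree_auts" and aw: "a w \<noteq> w"
  shows "a (graft w f (finv a (graft w f' x))) = graft w f' (a (graft w f (finv a x)))"
proof -
  define D where "D = (\<lambda>x. a (graft w f (finv a x)))"
  have suf: "suffix w (finv a x) \<longleftrightarrow> suffix (a w) x" for x
    using suffix_tree_auts[OF a, of w "finv a x"] a by simp
  have D: "suffix (a w) (D x) \<longleftrightarrow> suffix (a w) x" for x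
    unfolding D_def by (simp add: suffix_tree_auts[OF a] suffix_graft suf)
  have D_out: "D x = x" if "\<not> suffix (a w) x" for x
    using that a unfolding D_def by (simp add: graft_outside suf)
  have excl: "\<not> suffix (a w) x" if "suffix w x" for x
    using suffix_same_length[OF that, of "a w"] a aw by auto
  have "D (graft w f' x) = graft w f' (D x)"
  proof (cases "suffix w x")
    case True
    then show ?thesis by (simp add: D_out excl suffix_graft)
  next
    case False
    moreover have "\<not> suffix w (D x)"
      using False D excl D_out by metis
    ultimately show ?thesis by (simp add: graft_outside)
  qed
  then show ?thesis by (simp add: D_def)
qed

text \<open>If \<open>a\<close> moves \<open>w\<close> and \<open>X\<close>, \<open>Y\<close> live below \<open>w\<close>, then \<open>[[a, X], Y] = [X, Y]\<close> again lives below
  \<open>w\<close>. If \<open>X\<close> and \<open>Y\<close> normalise \<open>A\<close>, this element lies in \<open>A\<close>, so it commutes with \<open>B\<close>,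
  which forces \<open>B\<close> to fix \<open>w\<close>.\<close>

lemma centralizing_pair_disjoint_supports:
  assumes "finite S" and A: "A = cent (sign_kernel S) B" and B: "B \<subseteq> sign_kernel S"
    and sq: "\<And>h. h \<in> sign_kernel S \<Longrightarrow> conjugates (h \<circ> h) A A"
    and "a \<in> A" "b \<in> B" "a v \<noteq> v"
  shows "b v = v"
proof (rule ccontr)
  assume "b v \<noteq> v"
  have "\<exists>m. \<forall>k\<in>S. k < m" using \<open>finite S\<close> by (simp add: finite_nat_set_iff_bounded)
  then obtain m where m: "\<And>k. k \<in> S \<Longrightarrow> k < m" by blast
  \<comment> \<open>Passing to a descendant of \<open>v\<close> below all levels of \<open>S\<close>
    gives every graft at \<open>w\<close> the sign 1.\<close>
  define w where "w = replicate m True @ v"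
  have a: "a \<in> tree_auts" and b: "b \<in> tree_auts"
    using \<open>a \<in> A\<close> \<open>b \<in> B\<close> A B cent_subset sign_kernel_tree_auts by blast+
  have aw: "a w \<noteq> w" and bw: "b w \<noteq> w"
    using tree_auts_fixes_append a b \<open>a v \<noteq> v\<close> \<open>b v \<noteq> v\<close> unfolding w_def by blast+
  have deep: "graft w g \<in> sign_kernel S" if "g \<in> tree_auts" for g
  proof -
    have empty: "{k. k + length w \<in> S} = {}" using m by (fastforce simp: w_def)
    show ?thesis using that \<open>finite S\<close>
      by (simp add: sign_kernel_def level_sign_graft empty) (simp add: level_sign_def)
  qed
  have A_comp: "g \<circ> h \<in> A" if "g \<in> A" "h \<in> A" for g h
  proof -
    have "g \<circ> h \<circ> c = c \<circ> (g \<circ> h)" if "c \<in> B" for c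
      using that \<open>g \<in> A\<close> \<open>h \<in> A\<close> A by (auto simp: cent_def fun_eq_iff)
    then show ?thesis using that A by (simp add: cent_def)
  qed
  have A_inv: "finv g \<in> A" if "g \<in> A" for g
  proof -
    have g: "g \<in> sign_kernel S" "g \<in> tree_auts"
      using that A by (auto simp: cent_def sign_kernel_tree_auts)
    have "finv g \<circ> c = c \<circ> finv g" if "c \<in> B" for c
    proof
      fix x
      have "g (c (finv g x)) = c (g (finv g x))"
        using \<open>g \<in> A\<close> \<open>c \<in> B\<close> A by (auto simp: cent_def fun_eq_iff)
      then have "g (c (finv g x)) = c x" using g(2) by simp
      then have "finv g (c x) = c (finv g x)" using g(2) by (metis inv_tree_auts_simps(1))
      then show "(finv g \<circ> c) x = (c \<circ> finv g) x" by simp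
    qed
    then show ?thesis using g A by (simp add: cent_def)
  qed
  obtain x y X0 Y0 where x: "x \<in> tree_auts" "y \<in> tree_auts" "X0 = x \<circ> x" "Y0 = y \<circ> y"
    and inv0: "X0 \<circ> X0 = id" "Y0 \<circ> Y0 = id" and ne: "X0 \<circ> Y0 \<circ> X0 \<circ> Y0 \<noteq> id"
    by (rule ex_noncommuting_squares)
  define X where "X = graft w X0"
  define Y where "Y = graft w Y0"
  have XX: "X (X z) = z" for z
    using fun_cong[OF graft_comp[of w X0 X0], of z] inv0(1) by (simp add: X_def)
  have YY: "Y (Y z) = z" for z
    using fun_cong[OF graft_comp[of w Y0 Y0], of z] inv0(2) by (simp add: Y_def)
  have "conjugates X A A" "conjugates Y A A"
    using sq[OF deep[OF x(1)]] sq[OF deep[OF x(2)]] by (simp_all add: X_def Y_def x graft_comp)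
  then have XA: "X \<circ> g \<circ> X \<in> A" and YA: "Y \<circ> g \<circ> Y \<in> A" if gA: "g \<in> A" for g
  proof -
    obtain c where c: "c \<in> A" "X \<circ> g = c \<circ> X" using conjugatesD[OF \<open>conjugates X A A\<close> gA] by blast
    then have "X \<circ> g \<circ> X = c" by (simp add: fun_eq_iff XX)
    with c show "X \<circ> g \<circ> X \<in> A" by simp
    obtain c where c: "c \<in> A" "Y \<circ> g = c \<circ> Y" using conjugatesD[OF \<open>conjugates Y A A\<close> gA] by blast
    then have "Y \<circ> g \<circ> Y = c" by (simp add: fun_eq_iff YY)
    with c show "Y \<circ> g \<circ> Y \<in> A" by simp
  qed
  \<comment> \<open>The conjugate of \<open>X\<close> by \<open>a\<close>, living below
    \<open>a w\<close>, hence commuting with \<open>X\<close> and \<open>Y\<close>.\<close>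
  define D where "D = (\<lambda>z. a (X (finv a z)))"
  have DX: "D (X z) = X (D z)" and DY: "D (Y z) = Y (D z)" for z
    unfolding D_def X_def Y_def by (rule graft_commutes_with_conjugate[OF a aw])+
  have DD: "D (D z) = z" for z using a by (simp add: D_def XX)
  \<comment> \<open>In terms of \<open>D\<close> these are \<open>D X\<close> and its inverse
    \<open>X D\<close>. In the product \<open>D X Y X D Y\<close> the two factors \<open>D\<close>
    move together and cancel, leaving the commutator of \<open>X\<close> and
    \<open>Y\<close>.\<close>
  have "a \<circ> (X \<circ> finv a \<circ> X) \<in> A" "(X \<circ> a \<circ> X) \<circ> finv a \<in> A"
    using A_comp A_inv XA \<open>a \<in> A\<close> by blast+
  then have "(a \<circ> (X \<circ> finv a \<circ> X)) \<circ> (Y \<circ> ((X \<circ> a \<circ> X) \<circ> finv a) \<circ> Y) \<in> A"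
    using A_comp YA by blast
  moreover have "(a \<circ> (X \<circ> finv a \<circ> X)) \<circ> (Y \<circ> ((X \<circ> a \<circ> X) \<circ> finv a) \<circ> Y) = X \<circ> Y \<circ> X \<circ> Y"
  proof
    fix z
    have "((a \<circ> (X \<circ> finv a \<circ> X)) \<circ> (Y \<circ> ((X \<circ> a \<circ> X) \<circ> finv a) \<circ> Y)) z = D (X (Y (X (D (Y z)))))"
      by (simp add: D_def)
    also have "\<dots> = (X \<circ> Y \<circ> X \<circ> Y) z" by (simp add: DX DY DD)
    finally show "((a \<circ> (X \<circ> finv a \<circ> X)) \<circ> (Y \<circ> ((X \<circ> a \<circ> X) \<circ> finv a) \<circ> Y)) z
      = (X \<circ> Y \<circ> X \<circ> Y) z" .
  qed
  ultimately have "X \<circ> Y \<circ> X \<circ> Y \<in> A" by simp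
  moreover define Z where "Z = X0 \<circ> Y0 \<circ> X0 \<circ> Y0"
  have "X \<circ> Y \<circ> X \<circ> Y = graft w Z" by (simp add: X_def Y_def Z_def graft_comp)
  ultimately have comm: "graft w Z \<circ> b = b \<circ> graft w Z" using \<open>b \<in> B\<close> A by (simp add: cent_def)
  have "Z u = u" for u
  proof -
    \<comment> \<open>Since \<open>b\<close> carries the subtree below \<open>w\<close> off itself,
      the graft acts trivially on the image; commuting with \<open>b\<close>, it must be trivial
      below \<open>w\<close> as well.\<close>
    have "\<not> suffix w (b (u @ w))"
    proof
      assume "suffix w (b (u @ w))"
      moreover have "suffix (b w) (b (u @ w))" using b by (simp add: suffix_tree_auts)
      ultimately show False using suffix_same_length bw b by (metis length_tree_auts)
    qed
    then have "b (u @ w) = b (Z u @ w)"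
      using fun_cong[OF comm, of "u @ w"] by (simp add: graft_outside)
    then show ?thesis using b by (simp add: tree_auts_eq_iff)
  qed
  then show False using ne by (simp add: Z_def fun_eq_iff)
qed

lemma centralizing_pair_subset:
  "centralizing_pair (sign_kernel S) A B \<Longrightarrow> A \<subseteq> sign_kernel S"
  by (metis cent_subset centralizing_pair_def)

lemma centralizing_pair_tree_auts:
  "centralizing_pair (sign_kernel S) A B \<Longrightarrow> A \<subseteq> tree_auts"
  using centralizing_pair_subset sign_kernel_tree_auts by blast

lemma permuted_pair_not_both_moves:
  assumes "finite S" "permuted_pair (sign_kernel S) A B" "moves A v"
  shows "\<not> moves B v"
proof -
  have "A = cent (sign_kernel S) B" "B = cent (sign_kernel S) A"
    using assms(2) unfolding permuted_pair_def centralizing_pair_def by blast+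
  then show ?thesis
    using centralizing_pair_disjoint_supports[OF assms(1), of A B]
      permuted_pair_square(1)[OF assms(2)] cent_subset assms(3) unfolding moves_def by metis
qed

lemma centralizing_pair_moves:
  assumes "centralizing_pair (sign_kernel S) A B"
  obtains n where "\<And>m. n \<le> m \<Longrightarrow> \<exists>v. length v = m \<and> moves A v"
proof -
  \<comment> \<open>Once \<open>id\<close> lies in \<open>A\<close>, the condition
    \<open>A \<noteq> {id}\<close> yields an element different from \<open>id\<close>.\<close>
  have "id \<in> cent (sign_kernel S) B" by (simp add: cent_def)
  then have "id \<in> A" using assms unfolding centralizing_pair_def by blast
  then obtain a where "a \<in> A" "a \<noteq> id" using assms unfolding centralizing_pair_def by blast
  then obtain v where v: "moves A v" unfolding moves_def by (metis eq_id_iff)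
  have "\<exists>x. length x = m \<and> moves A x" if "length v \<le> m" for m
  proof -
    have "moves A (replicate (m - length v) True @ v)"
      using v moves_append centralizing_pair_tree_auts[OF assms] by blast
    moreover have "length (replicate (m - length v) True @ v) = m" using that by simp
    ultimately show ?thesis by blast
  qed
  then show thesis using that by blast
qed

text \<open>On a deep level \<open>A\<close> moves some \<open>v\<close> and \<open>B\<close> some
  \<open>w\<close>. Transitivity carries \<open>v\<close> to \<open>w\<close>, and normality makes
  \<open>A\<close> move \<open>w\<close> too, contradicting disjointness of supports.\<close>

lemma no_normal_pair:
  assumes "finite S" "S \<noteq> {0}"
  shows "\<not> normal_pair (sign_kernel S) A B"
proof
  assume np: "normal_pair (sign_kernel S) A B"
  then have pp: "permuted_pair (sign_kernel S) A B" by (auto simp: normal_pair_def permuted_pair_def)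
  then have cp: "centralizing_pair (sign_kernel S) A B" by (simp add: permuted_pair_def)
  obtain n where n: "\<And>m. n \<le> m \<Longrightarrow> \<exists>v. length v = m \<and> moves A v"
    using centralizing_pair_moves[OF cp] by blast
  obtain n' where n': "\<And>m. n' \<le> m \<Longrightarrow> \<exists>v. length v = m \<and> moves B v"
    using centralizing_pair_moves[OF centralizing_pair_commute[OF cp]] by blast
  obtain v w where vw: "length v = max n n'" "moves A v" "length w = max n n'" "moves B w"
    using n[of "max n n'"] n'[of "max n n'"] by auto
  obtain h where h: "h \<in> sign_kernel S" "h v = w"
    using sign_kernel_transitive[OF assms] vw by metis
  have "moves A w"
    using np h vw(2) conjugates_moves[of h A A v] sign_kernel_tree_auts[OF h(1)]
    by (auto simp: normal_pair_def bij_is_inj tree_auts_bij)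
  then show False using permuted_pair_not_both_moves[OF assms(1) pp] vw by blast
qed

section \<open>The two halves of the tree\<close>

text \<open>The elements supported below the child \<open>[i]\<close> of the root: the last letter
  of a word is the first step from the root.\<close>

definition half :: "nat set \<Rightarrow> bool \<Rightarrow> (bool list \<Rightarrow> bool list) set" where
  "half S i = {g \<in> sign_kernel S. \<forall>w. g (w @ [\<not> i]) = w @ [\<not> i]}"

lemma half_subset: "half S i \<subseteq> sign_kernel S"
  by (auto simp: half_def)

lemma suffix_singleton_append [simp]: "suffix [i] (u @ [j]) \<longleftrightarrow> i = j"
  by (auto simp: suffix_def)

text \<open>An element of the half is determined by its portrait below \<open>[i]\<close>, where
  levels are shifted by one. This identification drives the induction on the level bound.\<close>

lemma half_eq_graft:
  assumes "finite S"
  shows "half S i = graft [i] ` sign_kernel {k. Suc k \<in> S}"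
proof (intro equalityI subsetI)
  fix g assume "g \<in> half S i"
  then have g: "g \<in> tree_auts" "level_sign S g = 1" and fx: "\<And>w. g (w @ [\<not> i]) = w @ [\<not> i]"
    by (auto simp: half_def sign_kernel_def)
  define f where "f = aut (\<lambda>u. flips g (u @ [i]))"
  have eq: "g = graft [i] f"
  proof (rule tree_auts_eqI)
    fix w
    show "flips g w = flips (graft [i] f) w"
    proof (cases w rule: rev_cases)
      case Nil
      have "g [\<not> i] = [\<not> i]" using fx[of "[]"] by simp
      then have "\<not> flips g []" using g(1) by (auto simp: tree_auts_Cons)
      then show ?thesis using Nil by (simp add: f_def graft_eq_aut)
    next
      case (snoc u j)
      have "\<not> flips g (u @ [\<not> i])" using fx[of "True # u"] by (simp add: flips_def)
      then show ?thesis using snoc by (cases "j = i") (auto simp: f_def graft_eq_aut)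
    qed
  qed (use g in \<open>auto simp: f_def\<close>)
  have f: "f \<in> tree_auts" by (simp add: f_def)
  have "level_sign {k. Suc k \<in> S} f = 1"
    using level_sign_graft[OF assms f, of "[i]"] g(2) unfolding eq[symmetric] by simp
  with f have "f \<in> sign_kernel {k. Suc k \<in> S}" by (simp add: sign_kernel_def)
  then show "g \<in> graft [i] ` sign_kernel {k. Suc k \<in> S}" using eq by blast
next
  fix g assume "g \<in> graft [i] ` sign_kernel {k. Suc k \<in> S}"
  then obtain f where f: "f \<in> sign_kernel {k. Suc k \<in> S}" "g = graft [i] f" by blast
  then show "g \<in> half S i"
    using level_sign_graft[OF assms, of f "[i]"]
    by (auto simp: half_def sign_kernel_def graft_outside)
qed

lemma half_commute:
  assumes "finite S" "f \<in> half S i" "g \<in> half S (\<not> i)"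
  shows "f \<circ> g = g \<circ> f"
proof
  fix x
  obtain f' g' where "f = graft [i] f'" "g = graft [\<not> i] g'"
    using assms(2,3) unfolding half_eq_graft[OF assms(1)] by blast
  moreover have "graft [i] h (u @ [\<not> i]) = u @ [\<not> i]" "graft [\<not> i] h (u @ [i]) = u @ [i]" for h u
    by (simp_all add: graft_outside)
  moreover have "graft [i] h [] = []" for h i by (simp add: graft_def)
  ultimately show "(f \<circ> g) x = (g \<circ> f) x"
    by (cases x rule: rev_cases; cases "last x = i") auto
qed

text \<open>A swap below all levels of \<open>S\<close> has sign 1, and ending in \<open>i\<close>
  keeps it away from the other half.\<close>

lemma deep_swap_half:
  assumes "finite S"
  obtains m where "\<And>w. swap_at (replicate m True @ w @ [i]) \<in> half S i"
proof -
  have "\<exists>m. \<forall>k\<in>S. k < m" using assms by (simp add: finite_nat_set_iff_bounded)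
  then obtain m where m: "\<And>k. k \<in> S \<Longrightarrow> k < m" by blast
  have "swap_at (replicate m True @ w @ [i]) \<in> half S i" for w
  proof -
    have "length (replicate m True @ w @ [i]) \<notin> S" using m by fastforce
    then have "swap_at (replicate m True @ w @ [i]) \<in> sign_kernel S"
      by (simp add: sign_kernel_def level_sign_swap_at assms)
    moreover have "\<not> strict_suffix (replicate m True @ w @ [i]) (u @ [\<not> i])" for u
    proof
      assume "strict_suffix (replicate m True @ w @ [i]) (u @ [\<not> i])"
      then obtain y where "u @ [\<not> i] = y @ replicate m True @ w @ [i]"
        by (auto simp: strict_suffix_def suffix_def)
      then have "last (u @ [\<not> i]) = last (y @ replicate m True @ w @ [i])" by (rule arg_cong)
      then show False by simp
    qed
    ultimately show ?thesis by (simp add: half_def swap_at_fixes)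
  qed
  then show thesis using that by blast
qed

lemma half_nontrivial:
  assumes "finite S"
  shows "half S i \<noteq> {id}"
proof -
  obtain m where "\<And>w. swap_at (replicate m True @ w @ [i]) \<in> half S i"
    using deep_swap_half[OF assms] by blast
  then have "swap_at (replicate m True @ [] @ [i]) \<in> half S i" by blast
  moreover have "swap_at u \<noteq> id" for u
    using flips_swap_at[of u u] by (metis flips_id)
  ultimately show ?thesis by blast
qed

lemma half_inter: "half S i \<inter> half S (\<not> i) \<subseteq> {id}"
proof
  fix g assume g: "g \<in> half S i \<inter> half S (\<not> i)"
  have "g x = x" for x
  proof (cases x rule: rev_cases)
    case Nil
    then show ?thesis using g by (auto simp: half_def sign_kernel_def)
  next
    case (snoc u j)
    then show ?thesis using g by (cases "j = i") (auto simp: half_def)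
  qed
  then show "g \<in> {id}" by auto
qed

text \<open>If \<open>g\<close> moves a vertex of half \<open>i\<close>, it moves a deep descendant
  \<open>u\<close> whose swap lies in the half. The children of \<open>g u\<close> are fixed by this
  swap while those of \<open>u\<close> are exchanged, so \<open>g\<close> cannot commute with
  it.\<close>

lemma cent_half:
  assumes "finite S"
  shows "cent (sign_kernel S) (half S i) = half S (\<not> i)"
proof (intro equalityI subsetI)
  show "g \<in> cent (sign_kernel S) (half S i)" if "g \<in> half S (\<not> i)" for g
    using that half_subset[of S "\<not> i"] half_commute[OF assms _ that] by (auto simp: cent_def)
next
  fix g assume g: "g \<in> cent (sign_kernel S) (half S i)"
  then have ga: "g \<in> tree_auts" by (simp add: cent_def sign_kernel_def)
  obtain m where m: "\<And>w. swap_at (replicate m True @ w @ [i]) \<in> half S i"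
    using deep_swap_half[OF assms] by blast
  have "g (w @ [i]) = w @ [i]" for w
  proof (rule ccontr)
    assume "g (w @ [i]) \<noteq> w @ [i]"
    define u where "u = replicate m True @ w @ [i]"
    have "g u \<noteq> u"
      using tree_auts_fixes_append[OF ga] \<open>g (w @ [i]) \<noteq> w @ [i]\<close> unfolding u_def by blast
    have out: "swap_at u (c # g u) = c # g u" for c
    proof (rule swap_at_fixes)
      show "\<not> strict_suffix u (c # g u)"
      proof
        assume "strict_suffix u (c # g u)"
        then have "u = c # g u \<or> suffix u (g u)" by (auto simp: strict_suffix_def suffix_Cons)
        then show False
          using ga \<open>g u \<noteq> u\<close> suffix_same_length[of u "g u" "g u"]
          by (metis length_Cons length_tree_auts n_not_Suc_n suffix_order.refl)
      qed
    qed
    have "g \<circ> swap_at u = swap_at u \<circ> g" using g m[of w] by (simp add: cent_def u_def)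
    from fun_cong[OF this, of "True # u"] have "g (False # u) = swap_at u (g (True # u))" by simp
    also have "\<dots> = g (True # u)" using ga by (simp add: tree_auts_Cons out)
    finally show False using ga by (simp add: tree_auts_eq_iff)
  qed
  then show "g \<in> half S (\<not> i)" using g by (simp add: half_def cent_def)
qed

lemma tree_auts_snoc:
  assumes "h \<in> tree_auts" "h [i] = [j]"
  shows "\<exists>u'. h (u @ [i]) = u' @ [j]" "\<exists>u'. h (u @ [\<not> i]) = u' @ [\<not> j]"
proof -
  have "h [\<not> i] = [\<not> j]" using assms by (auto simp: tree_auts_Cons)
  then show "\<exists>u'. h (u @ [i]) = u' @ [j]" "\<exists>u'. h (u @ [\<not> i]) = u' @ [\<not> j]"
    using tree_auts_append[OF assms(1), of u "[i]"] tree_auts_append[OF assms(1), of u "[\<not> i]"]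
      assms(2) by auto
qed

lemma half_conj:
  assumes "h \<in> sign_kernel S" "h [i] = [j]" "a \<in> half S i"
  shows "h \<circ> a \<circ> finv h \<in> half S j"
proof -
  have h: "h \<in> tree_auts" using assms(1) by (rule sign_kernel_tree_auts)
  have "finv h [j] = [i]" using assms(2) h by (metis inv_tree_auts_simps(1))
  have "(h \<circ> a \<circ> finv h) (w @ [\<not> j]) = w @ [\<not> j]" for w
  proof -
    obtain w' where w': "finv h (w @ [\<not> j]) = w' @ [\<not> i]"
      using tree_auts_snoc(2)[OF inv_tree_auts[OF h] \<open>finv h [j] = [i]\<close>] by blast
    have "a (w' @ [\<not> i]) = w' @ [\<not> i]" using assms(3) by (simp add: half_def)
    then have "(h \<circ> a \<circ> finv h) (w @ [\<not> j]) = h (finv h (w @ [\<not> j]))" by (simp add: w')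
    then show ?thesis using h by simp
  qed
  moreover have "h \<circ> a \<circ> finv h \<in> sign_kernel S"
    using assms(1,3) half_subset by (meson comp_sign_kernel inv_sign_kernel subsetD)
  ultimately show ?thesis by (simp add: half_def)
qed

lemma conjugates_half:
  assumes "h \<in> sign_kernel S" "h [i] = [j]"
  shows "conjugates h (half S i) (half S j)"
proof (rule conjugatesI)
  have h: "h \<in> tree_auts" using assms(1) by (rule sign_kernel_tree_auts)
  have hi: "finv h [j] = [i]" using assms(2) h by (metis inv_tree_auts_simps(1))
  show "\<exists>b\<in>half S j. h \<circ> a = b \<circ> h" if "a \<in> half S i" for a
    using half_conj[OF assms that] h by (intro bexI[of _ "h \<circ> a \<circ> finv h"]) (auto simp: fun_eq_iff)
  show "\<exists>a\<in>half S i. h \<circ> a = b \<circ> h" if "b \<in> half S j" for b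
    using half_conj[OF inv_sign_kernel[OF assms(1)] hi that] h tree_auts_bij[OF h]
    by (intro bexI[of _ "finv h \<circ> b \<circ> h"]) (auto simp: fun_eq_iff inv_inv_eq)
qed

lemma centralizing_pair_half:
  "finite S \<Longrightarrow> centralizing_pair (sign_kernel S) (half S i) (half S (\<not> i))"
  using cent_half[of S i] cent_half[of S "\<not> i"] half_nontrivial
  by (simp add: centralizing_pair_def)

lemma conjugates_half_cases:
  assumes "h \<in> sign_kernel S"
  shows "h [True] = [True] \<and> (\<forall>i. conjugates h (half S i) (half S i)) \<or>
    h [True] \<noteq> [True] \<and> (\<forall>i. conjugates h (half S i) (half S (\<not> i)))"
proof -
  have h: "h \<in> tree_auts" using assms by (rule sign_kernel_tree_auts)
  have "h [i] = [i \<noteq> flips h []]" for i using h by (simp add: tree_auts_Cons)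
  then show ?thesis using conjugates_half[OF assms] by (cases "flips h []") auto
qed

lemma permuted_pair_half:
  assumes "finite S"
  shows "permuted_pair (sign_kernel S) (half S i) (half S (\<not> i))"
  unfolding permuted_pair_def
  using centralizing_pair_half[OF assms] conjugates_half_cases by (metis (full_types))

text \<open>For \<open>S = {0}\<close> the sign records just the flip at the root, so the whole
  kernel preserves each half.\<close>

lemma normal_pair_half:
  "normal_pair (sign_kernel {0}) (half {0} i) (half {0} (\<not> i))"
proof -
  have "h [True] = [True]" if "h \<in> sign_kernel {0}" for h
  proof -
    have "\<not> flips h []" using that by (auto simp: sign_kernel_def level_sign_def act_sign_def split: if_splits)
    then show ?thesis using that by (simp add: tree_auts_Cons sign_kernel_def)
  qed
  then show ?thesis unfolding normal_pair_def
    using centralizing_pair_half[of "{0}"] conjugates_half_cases by (metis finite.emptyI finite.insertI)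
qed

text \<open>The involution pairs the nonroot vertices of one half with those of the other. Since
  \<open>h \<circ> h\<close> has no flips, paired vertices have equal signs, and only the flip at
  the root survives in the product.\<close>

lemma level_sign_involution:
  assumes "finite S" "h \<in> tree_auts" "h \<circ> h = id" "h [True] \<noteq> [True]"
  shows "level_sign S h = (if 0 \<in> S then -1 else 1)"
proof -
  define W where "W = (\<lambda>i. {w :: bool list. length w \<in> S \<and> w \<noteq> [] \<and> last w = i})"
  have fl: "flips h []" using assms(2,4) by (simp add: tree_auts_Cons)
  have fin: "finite (W i)" for i
    using finite_level_words[OF assms(1)] by (rule rev_finite_subset) (auto simp: W_def)
  have hh: "h (h x) = x" for x using fun_cong[OF assms(3), of x] by simp
  have hW: "h w \<in> W (\<not> i)" if "w \<in> W i" for w i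
  proof -
    have u: "w = butlast w @ [i]" using that append_butlast_last_id[of w] by (simp add: W_def)
    have "h [i] = [\<not> i]" using fl assms(2) by (simp add: tree_auts_Cons)
    then obtain u' where "h w = u' @ [\<not> i]" using tree_auts_snoc(1)[OF assms(2)] u by metis
    moreover have "length (h w) \<in> S" using that assms(2) by (simp add: W_def)
    ultimately show ?thesis by (simp add: W_def)
  qed
  have "bij_betw h (W True) (W False)"
    by (rule bij_betwI[where g = h]) (use hW hh in force)+
  then have "(\<Prod>w\<in>W False. act_sign h w) = (\<Prod>w\<in>W True. act_sign h (h w))"
    using prod.reindex_bij_betw by metis
  also have "\<dots> = (\<Prod>w\<in>W True. act_sign h w)"
  proof (rule prod.cong)
    fix w
    have "act_sign (h \<circ> h) w = act_sign h w * act_sign h (h w)"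
      using assms(2) by (simp add: act_sign_comp)
    then show "act_sign h (h w) = act_sign h w"
      using assms(3) by (auto simp: act_sign_def split: if_splits)
  qed simp
  finally have eq: "(\<Prod>w\<in>W False. act_sign h w) * (\<Prod>w\<in>W True. act_sign h w) = 1"
    by (simp add: prod.distrib[symmetric]) (rule prod.neutral, simp add: act_sign_def)
  have "{w. length w \<in> S} = (if 0 \<in> S then {[]} else {}) \<union> (W False \<union> W True)"
    by (auto simp: W_def)
  moreover have "(\<Prod>w\<in>W False \<union> W True. act_sign h w) = 1"
  proof -
    have "W False \<inter> W True = {}" by (auto simp: W_def)
    then show ?thesis using eq fin by (simp add: prod.union_disjoint)
  qed
  moreover have "[] \<notin> W False \<union> W True" by (simp add: W_def)
  ultimately show ?thesis using fl fin by (simp add: level_sign_def act_sign_def)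
qed

text \<open>This expresses membership of 0 in \<open>S\<close> through data that multiplicative
  bijections matching the halves preserve. The witness for \<open>0 \<notin> S\<close> is the swap
  at the root.\<close>

lemma half_swapping_involution_iff:
  assumes "finite S"
  shows "(\<exists>h\<in>sign_kernel S. h \<circ> h = id \<and> conjugates h (half S i) (half S (\<not> i))) \<longleftrightarrow> 0 \<notin> S"
proof
  assume "\<exists>h\<in>sign_kernel S. h \<circ> h = id \<and> conjugates h (half S i) (half S (\<not> i))"
  then obtain h where h: "h \<in> sign_kernel S" "h \<circ> h = id" "conjugates h (half S i) (half S (\<not> i))"
    by blast
  have ht: "h \<in> tree_auts" using h(1) by (rule sign_kernel_tree_auts)
  have "h [True] \<noteq> [True]"
  proof
    assume "h [True] = [True]"
    then have "conjugates h (half S i) (half S i)" using conjugates_half_cases[OF h(1)] by blast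
    then have "half S i = half S (\<not> i)"
      using conjugates_inj[OF _ _ h(3)] tree_auts_bij[OF ht] by (auto simp: bij_def)
    then have "half S i \<subseteq> {id}" using half_inter[of S i] by simp
    moreover have "id \<in> half S i" by (simp add: half_def)
    ultimately show False using half_nontrivial[OF assms, of i] by blast
  qed
  then show "0 \<notin> S"
    using level_sign_involution[OF assms ht h(2)] h(1) by (auto simp: sign_kernel_def split: if_splits)
next
  assume "0 \<notin> S"
  then have "swap_at [] \<in> sign_kernel S" using assms by (simp add: sign_kernel_def level_sign_swap_at)
  moreover have "swap_at [] \<circ> swap_at [] = id"
    unfolding swap_at_def by (rule aut_involution) (metis length_0_conv length_aut)
  moreover have "swap_at [] [i] = [\<not> i]" by simp
  ultimately show "\<exists>h\<in>sign_kernel S. h \<circ> h = id \<and> conjugates h (half S i) (half S (\<not> i))"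
    using conjugates_half by blast
qed

section \<open>Recognising the halves\<close>

lemma swap_at_fixes_last:
  assumes "u \<noteq> []" "r \<noteq> []" "last r \<noteq> last u"
  shows "swap_at u r = r"
proof (rule swap_at_fixes)
  show "\<not> strict_suffix u r"
    using assms by (auto simp: strict_suffix_def suffix_def)
qed

text \<open>For \<open>T = {1}\<close> this fails: that kernel acts on the second level as the Klein four-group,
  which has three systems of two blocks.\<close>

lemma ex_child_swap:
  assumes "finite T" "T \<noteq> {0}" "T \<noteq> {1}" "u \<noteq> []"
  shows "\<exists>h\<in>sign_kernel T. h (c # u) = (\<not> c) # u \<and>
    ((\<forall>n>0. \<exists>r. length r = n \<and> h r = r) \<or> (\<exists>g\<in>sign_kernel T. h = g \<circ> g))"
proof -
  \<comment> \<open>Both alternatives in the goal serve to show that \<open>h\<close> cannot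
    interchange a permuted pair: it fixes a vertex on the level considered, or it is a
    square.\<close>
  have fixed: "\<exists>r. length r = n \<and> swap_at u (swap_at z r) = r"
    if "z \<noteq> []" "last z = last u" "0 < n" for n z
  proof -
    define r where "r = replicate n (\<not> last u)"
    have "r \<noteq> []" "last r \<noteq> last u" using that(3) by (simp_all add: r_def)
    then have "swap_at u (swap_at z r) = r"
      using that assms(4) by (simp add: swap_at_fixes_last)
    then show ?thesis by (intro exI[of _ r]) (simp add: r_def)
  qed
  \<comment> \<open>The sign of \<open>swap_at u\<close> is corrected by a swap at \<open>z\<close>
    in the same half, so that the other half stays fixed pointwise.\<close>
  have two: ?thesis
    if z: "length z \<in> T" "length u \<in> T" "z \<noteq> []" "last z = last u" "swap_at z (c # u) = c # u" for z
  proof -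
    have "swap_at u \<circ> swap_at z \<in> sign_kernel T"
      using z assms(1) by (simp add: sign_kernel_def level_sign_comp level_sign_swap_at)
    moreover have "(swap_at u \<circ> swap_at z) (c # u) = (\<not> c) # u" using z(5) by simp
    moreover have "\<forall>n>0. \<exists>r. length r = n \<and> (swap_at u \<circ> swap_at z) r = r"
      using fixed z by simp
    ultimately show ?thesis by blast
  qed
  consider (outside) "length u \<notin> T" | (deep) "length u \<in> T" "2 \<le> length u"
    | (top) "length u \<in> T" "length u = 1" "\<exists>l\<in>T. 2 \<le> l" | (zero) "length u = 1" "0 \<in> T" "1 \<in> T"
  proof -
    have "0 \<in> T" if "1 \<in> T" "\<not> (\<exists>l\<in>T. 2 \<le> l)"
    proof (rule ccontr)
      assume "0 \<notin> T"
      then have "l = 1" if "l \<in> T" for l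
        using that \<open>\<not> (\<exists>l\<in>T. 2 \<le> l)\<close> by (cases l; cases "l - 1") auto
      then have "T = {1}" using \<open>1 \<in> T\<close> by blast
      then show False using assms(3) by simp
    qed
    moreover have "length u = 1 \<or> 2 \<le> length u" using assms(4) by (cases u; cases "tl u") auto
    ultimately show thesis using that by metis
  qed
  then show ?thesis
  proof cases
    case outside
    then have "swap_at u \<in> sign_kernel T"
      using assms(1) by (simp add: sign_kernel_def level_sign_swap_at)
    moreover have "\<exists>r. length r = n \<and> swap_at u r = r" if "0 < n" for n
    proof -
      have "swap_at u (replicate n (\<not> last u)) = replicate n (\<not> last u)"
        using that assms(4) by (intro swap_at_fixes_last) auto
      then show ?thesis by (intro exI[of _ "replicate n (\<not> last u)"]) simp
    qed
    ultimately show ?thesis using swap_at_Cons by blast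
  next
    case deep
    then obtain a b v where u: "u = a # b # v" by (cases u; cases "tl u") auto
    \<comment> \<open>Here \<open>z\<close> is the sibling of \<open>u\<close>; as \<open>u\<close>
      has length at least 2, both lie in the same half.\<close>
    have "swap_at ((\<not> a) # b # v) (c # u) = c # u"
      by (rule swap_at_fixes) (auto simp: u strict_suffix_def suffix_Cons dest: suffix_length_le)
    then show ?thesis using deep by (intro two[of "(\<not> a) # b # v"]) (auto simp: u)
  next
    case top
    then obtain l where l: "l \<in> T" "2 \<le> l" by blast
    show ?thesis
    proof (rule two)
      \<comment> \<open>As \<open>length u = 1\<close>, this descendant of \<open>u\<close> has
        level exactly \<open>l\<close>, too deep for its swap to affect the children of
        \<open>u\<close>.\<close>
      show "length (replicate (l - 1) True @ u) \<in> T" using l top(2) by simp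
      show "swap_at (replicate (l - 1) True @ u) (c # u) = c # u"
        using l top(2) by (intro swap_at_fixes_length) simp
    qed (use top assms(4) in auto)
  next
    case zero
    then obtain d where u: "u = [d]" by (cases u) auto
    \<comment> \<open>Flips on levels 0 and 1 give total sign 1. The square of \<open>g\<close>
      flips at both vertices of level one.\<close>
    define g where "g = swap_at [d] \<circ> swap_at []"
    have "g \<in> sign_kernel T"
      using zero assms(1) by (simp add: g_def sign_kernel_def level_sign_comp level_sign_swap_at)
    moreover have "(g \<circ> g) (c # u) = (\<not> c) # u"
      by (simp add: g_def u swap_at_def)
    ultimately show ?thesis using comp_sign_kernel by blast
  qed
qed

text \<open>By transitivity every vertex of the level is moved by exactly one of \<open>A\<close>
  and \<open>B\<close>. Child swaps preserve these two blocks, so only the last letter matters, and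
  as both blocks occur they are the two halves.\<close>

lemma permuted_pair_moves_iff:
  assumes "finite T" "T \<noteq> {0}" "T \<noteq> {1}" "permuted_pair (sign_kernel T) A B"
    and n: "length v = n" "moves A v" "length v' = n" "moves B v'"
  shows "\<exists>i. \<forall>x. length x = n \<longrightarrow> (moves A x \<longleftrightarrow> last x = i) \<and> (moves B x \<longleftrightarrow> last x \<noteq> i)"
proof -
  note pp = assms(4)
  have not_both: "\<not> moves B x" if "moves A x" for x
    using permuted_pair_not_both_moves[OF assms(1) pp that] .
  have inj: "inj h" if "h \<in> sign_kernel T" for h
    using that by (simp add: bij_is_inj sign_kernel_tree_auts tree_auts_bij)
  have either: "moves A x \<noteq> moves B x" if lx: "length x = n" for x
  proof -
    obtain h where h: "h \<in> sign_kernel T" "h v = x"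
      using sign_kernel_transitive[OF assms(1,2), of v x] lx n(1) by metis
    have "conjugates h A A \<or> conjugates h A B" using pp h(1) by (auto simp: permuted_pair_def)
    then have "moves A x \<or> moves B x" using conjugates_moves inj[OF h(1)] n(2) h(2) by metis
    then show ?thesis using not_both by blast
  qed
  have step: "moves A (h x) \<longleftrightarrow> moves A x"
    if "conjugates h A A" "h \<in> sign_kernel T" for h x
    using conjugates_moves[OF that(1) inj[OF that(2)]] .
  have child: "\<exists>h\<in>sign_kernel T. h (c # u) = (\<not> c) # u \<and> conjugates h A A"
    if u: "u \<noteq> []" for u c
  proof -
    obtain h where h: "h \<in> sign_kernel T" "h (c # u) = (\<not> c) # u"
      and alt: "(\<forall>n>0. \<exists>r. length r = n \<and> h r = r) \<or> (\<exists>g\<in>sign_kernel T. h = g \<circ> g)"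
      using ex_child_swap[OF assms(1-3) u] by blast
    \<comment> \<open>A square normalises \<open>A\<close>. Otherwise \<open>h\<close> fixes a
      vertex of level \<open>n\<close>; being moved by just one of \<open>A\<close> and
      \<open>B\<close>, this vertex prevents an interchange.\<close>
    have "conjugates h A A"
    proof (cases "\<exists>g\<in>sign_kernel T. h = g \<circ> g")
      case True
      then show ?thesis using permuted_pair_square[OF pp] by blast
    next
      case False
      have "0 < n"
      proof (rule ccontr)
        assume "\<not> 0 < n"
        then have "v = v'" using n by simp
        then show False using n not_both by blast
      qed
      then obtain r where r: "length r = n" "h r = r" using False alt by blast
      have "\<not> conjugates h A B"
        using conjugates_moves[OF _ inj[OF h(1)], of A B r] either[OF r(1)] r(2) by auto
      then show ?thesis using pp h(1) by (auto simp: permuted_pair_def)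
    qed
    then show ?thesis using h by blast
  qed
  \<comment> \<open>Induction on the length of the part to be changed: a child swap adjusts the
    letter next to \<open>u\<close>, and the induction hypothesis for the longer suffix adjusts the
    rest.\<close>
  have same: "moves A (x @ u) \<longleftrightarrow> moves A (y @ u)"
    if "u \<noteq> []" "length (x @ u) = n" "length y = length x" for x y u
    using that
  proof (induction "length x" arbitrary: x y u)
    case 0
    then show ?case by simp
  next
    case (Suc k)
    obtain x' c where x: "x = x' @ [c]" using Suc.hyps(2) by (cases x rule: rev_cases) auto
    obtain y' d where y: "y = y' @ [d]" using Suc.hyps(2) Suc.prems(3) by (cases y rule: rev_cases) auto
    have lens: "k = length x'" "length y' = length x'" "length (x' @ c # u) = n"
      using Suc x y by simp_all
    obtain h where h: "h \<in> sign_kernel T" "h (c # u) = (\<not> c) # u" "conjugates h A A"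
      using child[OF Suc.prems(1)] by blast
    obtain z where z: "length z = length x'" "h (x' @ c # u) = z @ (\<not> c) # u"
      using tree_auts_append[OF sign_kernel_tree_auts[OF h(1)], of x' "c # u"] h(2) by auto
    have IH: "moves A (p @ e # u) \<longleftrightarrow> moves A (q @ e # u)"
      if "length p = length x'" "length q = length x'" for p q e
      using Suc.hyps(1)[of p "e # u" q] lens that by simp
    have "moves A (x' @ c # u) \<longleftrightarrow> moves A (z @ (\<not> c) # u)"
      using step[OF h(3,1), of "x' @ c # u"] z(2) by simp
    then have "moves A (x' @ c # u) \<longleftrightarrow> moves A (y' @ d # u)"
      using IH[of x' y' c] IH[of z y' "\<not> c"] lens z(1) by (cases "d = c") auto
    then show ?case by (simp add: x y)
  qed
  have last_eq: "moves A x \<longleftrightarrow> moves A y" if "length x = n" "length y = n" "x \<noteq> []" "last x = last y" for x y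
  proof -
    have "y \<noteq> []" using that by auto
    then have xy: "butlast x @ [last x] = x" "butlast y @ [last x] = y"
      unfolding that(4) using append_butlast_last_id[of x] append_butlast_last_id[of y] that(3,4) by simp_all
    have "length (butlast x @ [last x]) = n" "length (butlast y) = length (butlast x)"
      using that xy(1) by simp_all
    then show ?thesis using same[of "[last x]" "butlast x" "butlast y"] unfolding xy by simp
  qed
  have "v \<noteq> []" "v' \<noteq> []" using n not_both by auto
  have "last v \<noteq> last v'"
    using last_eq[of v v'] n \<open>v \<noteq> []\<close> either[of v'] by auto
  have A_iff: "moves A x \<longleftrightarrow> last x = last v" if "length x = n" for x
  proof (cases "last x = last v")
    case True
    then show ?thesis using last_eq[of v x] n that \<open>v \<noteq> []\<close> by auto
  next
    case False
    then have "last x = last v'" using \<open>last v \<noteq> last v'\<close> by auto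
    then have "moves A x \<longleftrightarrow> moves A v'" using last_eq[of v' x] n that \<open>v' \<noteq> []\<close> by auto
    then show ?thesis using False either[OF n(3)] n(4) by blast
  qed
  show ?thesis using A_iff either by blast
qed

text \<open>On deep levels \<open>A\<close> and \<open>B\<close> move opposite halves, the same ones
  on each level since moving passes to descendants. So each lies in a half, and taking centralizers
  reverses these inclusions.\<close>

lemma permuted_pair_eq_halves:
  assumes "finite T" "T \<noteq> {0}" "T \<noteq> {1}" and pp: "permuted_pair (sign_kernel T) A B"
  obtains i where "A = half T i" "B = half T (\<not> i)"
proof -
  have cp: "centralizing_pair (sign_kernel T) A B" using pp by (simp add: permuted_pair_def)
  then have cp': "centralizing_pair (sign_kernel T) B A" by (rule centralizing_pair_commute)
  obtain nA where nA: "\<And>m. nA \<le> m \<Longrightarrow> \<exists>v. length v = m \<and> moves A v"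
    using centralizing_pair_moves[OF cp] by blast
  obtain nB where nB: "\<And>m. nB \<le> m \<Longrightarrow> \<exists>v. length v = m \<and> moves B v"
    using centralizing_pair_moves[OF cp'] by blast
  define n where "n = Suc (max nA nB)"
  have ex: "\<exists>i. \<forall>x. length x = m \<longrightarrow> (moves A x \<longleftrightarrow> last x = i) \<and> (moves B x \<longleftrightarrow> last x \<noteq> i)"
    if m: "n \<le> m" for m
  proof -
    obtain v v' where "length v = m" "moves A v" "length v' = m" "moves B v'"
      using nA[of m] nB[of m] m unfolding n_def by (metis Suc_leD max.bounded_iff)
    then show ?thesis by (rule permuted_pair_moves_iff[OF assms(1-3) pp])
  qed
  obtain i where i: "\<And>x. length x = n \<Longrightarrow> (moves A x \<longleftrightarrow> last x = i) \<and> (moves B x \<longleftrightarrow> last x \<noteq> i)"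
    using ex[of n] by blast
  have unmoved: "\<not> moves A (w @ [\<not> i])" "\<not> moves B (w @ [i])" for w
  proof -
    define m where "m = n + length w"
    obtain j where j: "\<And>x. length x = m \<Longrightarrow> (moves A x \<longleftrightarrow> last x = j) \<and> (moves B x \<longleftrightarrow> last x \<noteq> j)"
      using ex[of m] by (auto simp: m_def)
    define r where "r = replicate n i"
    have "n \<noteq> 0" by (simp add: n_def)
    then have "moves A r" using i[of r] by (simp add: r_def)
    then have "moves A (replicate (length w) True @ r)"
      using moves_append centralizing_pair_tree_auts[OF cp] by blast
    then have "j = i" using j[of "replicate (length w) True @ r"] \<open>n \<noteq> 0\<close> by (simp add: m_def r_def)
    \<comment> \<open>With length \<open>n - 1\<close>, the vertex \<open>s @ w @ [c]\<close> is a
      descendant of \<open>w @ [c]\<close> on level \<open>m\<close>; if it is unmoved, so is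
      \<open>w @ [c]\<close>.\<close>
    define s where "s = replicate (n - 1) True"
    have "length (s @ w @ [c]) = m" for c using \<open>n \<noteq> 0\<close> by (simp add: s_def m_def)
    then have "\<not> moves A (s @ w @ [\<not> i])" "\<not> moves B (s @ w @ [i])"
      using j \<open>j = i\<close> by auto
    then show "\<not> moves A (w @ [\<not> i])" "\<not> moves B (w @ [i])"
      using moves_append centralizing_pair_tree_auts[OF cp] centralizing_pair_tree_auts[OF cp'] by blast+
  qed
  have "A \<subseteq> half T i"
    using unmoved(1) centralizing_pair_subset[OF cp] by (auto simp: half_def moves_def)
  moreover have "B \<subseteq> half T (\<not> i)"
    using unmoved(2) centralizing_pair_subset[OF cp'] by (auto simp: half_def moves_def)
  moreover have "half T (\<not> i) \<subseteq> B"
  proof -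
    have "cent (sign_kernel T) (half T i) \<subseteq> cent (sign_kernel T) A"
      using \<open>A \<subseteq> half T i\<close> by (auto simp: cent_def)
    moreover have "cent (sign_kernel T) A = B" using cp unfolding centralizing_pair_def by blast
    ultimately show ?thesis by (simp add: cent_half[OF assms(1)])
  qed
  moreover have "half T i \<subseteq> A"
  proof -
    have "cent (sign_kernel T) (half T (\<not> i)) \<subseteq> cent (sign_kernel T) B"
      using \<open>B \<subseteq> half T (\<not> i)\<close> by (auto simp: cent_def)
    moreover have "cent (sign_kernel T) B = A" using cp unfolding centralizing_pair_def by blast
    ultimately show ?thesis by (simp add: cent_half[OF assms(1)])
  qed
  ultimately show thesis using that[of i] by blast
qed

section \<open>Isomorphisms between sign kernels\<close>

text \<open>Stated for bare sets of maps, so that it applies to kernels and halves alike without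
  monoid records.\<close>

definition mult_iso :: "(('a \<Rightarrow> 'a) \<Rightarrow> 'b \<Rightarrow> 'b) \<Rightarrow> ('a \<Rightarrow> 'a) set \<Rightarrow> ('b \<Rightarrow> 'b) set \<Rightarrow> bool" where
  "mult_iso \<phi> G H \<longleftrightarrow> bij_betw \<phi> G H \<and> (\<forall>x\<in>G. \<forall>y\<in>G. \<phi> (x \<circ> y) = \<phi> x \<circ> \<phi> y)"

lemma mult_iso_comp:
  assumes "mult_iso \<phi> G H" "mult_iso \<psi> H K"
  shows "mult_iso (\<psi> \<circ> \<phi>) G K"
proof -
  have "\<phi> x \<in> H" if "x \<in> G" for x using assms(1) that by (auto simp: mult_iso_def bij_betw_def)
  then show ?thesis using assms by (auto simp: mult_iso_def intro: bij_betw_trans)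
qed

lemma mult_iso_inv:
  assumes "mult_iso \<phi> G H" and closed: "\<And>x y. x \<in> G \<Longrightarrow> y \<in> G \<Longrightarrow> x \<circ> y \<in> G"
  shows "mult_iso (inv_into G \<phi>) H G"
proof -
  have bij: "bij_betw \<phi> G H" using assms(1) by (simp add: mult_iso_def)
  have "inv_into G \<phi> (x \<circ> y) = inv_into G \<phi> x \<circ> inv_into G \<phi> y" if xyH: "x \<in> H" "y \<in> H" for x y
  proof -
    obtain x' y' where xy: "x' \<in> G" "x = \<phi> x'" "y' \<in> G" "y = \<phi> y'"
      using xyH bij by (auto simp: bij_betw_def)
    then have "x \<circ> y = \<phi> (x' \<circ> y')" using assms(1) by (simp add: mult_iso_def)
    moreover have "inv_into G \<phi> (\<phi> z) = z" if "z \<in> G" for z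
      using bij that by (simp add: bij_betw_def)
    ultimately show ?thesis using xy closed by simp
  qed
  then show ?thesis using bij by (simp add: mult_iso_def bij_betw_inv_into)
qed

lemma mult_iso_cent:
  assumes "mult_iso \<phi> G H" and closed: "\<And>x y. x \<in> G \<Longrightarrow> y \<in> G \<Longrightarrow> x \<circ> y \<in> G" and "A \<subseteq> G"
  shows "cent H (\<phi> ` A) = \<phi> ` cent G A"
proof -
  have H: "H = \<phi> ` G" and inj: "inj_on \<phi> G" using assms(1) by (auto simp: mult_iso_def bij_betw_def)
  have comm: "\<phi> g \<circ> \<phi> a = \<phi> a \<circ> \<phi> g \<longleftrightarrow> g \<circ> a = a \<circ> g" if "g \<in> G" "a \<in> G" for g a
  proof -
    have "\<phi> g \<circ> \<phi> a = \<phi> (g \<circ> a)" "\<phi> a \<circ> \<phi> g = \<phi> (a \<circ> g)"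
      using that assms(1) by (simp_all add: mult_iso_def)
    then show ?thesis using inj_on_eq_iff[OF inj] closed that by simp
  qed
  have "(\<forall>a\<in>A. \<phi> g \<circ> \<phi> a = \<phi> a \<circ> \<phi> g) \<longleftrightarrow> (\<forall>a\<in>A. g \<circ> a = a \<circ> g)" if "g \<in> G" for g
    using comm[OF that] assms(3) by blast
  then show ?thesis by (auto simp: cent_def H)
qed

lemma mult_iso_conjugates:
  assumes "mult_iso \<phi> G H" and closed: "\<And>x y. x \<in> G \<Longrightarrow> y \<in> G \<Longrightarrow> x \<circ> y \<in> G"
    and "h \<in> G" "A \<subseteq> G" "B \<subseteq> G"
  shows "conjugates (\<phi> h) (\<phi> ` A) (\<phi> ` B) \<longleftrightarrow> conjugates h A B"
proof -
  have inj: "inj_on \<phi> G" using assms(1) by (auto simp: mult_iso_def bij_betw_def)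
  have "(\<lambda>a. \<phi> h \<circ> a) ` \<phi> ` A = \<phi> ` (\<lambda>a. h \<circ> a) ` A"
    unfolding image_image by (rule image_cong) (use assms in \<open>auto simp: mult_iso_def\<close>)
  moreover have "(\<lambda>b. b \<circ> \<phi> h) ` \<phi> ` B = \<phi> ` (\<lambda>b. b \<circ> h) ` B"
    unfolding image_image by (rule image_cong) (use assms in \<open>auto simp: mult_iso_def\<close>)
  moreover have "(\<lambda>a. h \<circ> a) ` A \<subseteq> G" "(\<lambda>b. b \<circ> h) ` B \<subseteq> G" using assms by auto
  ultimately show ?thesis unfolding conjugates_def using inj_on_image_eq_iff[OF inj] by simp
qed

lemma mult_iso_id:
  assumes "mult_iso \<phi> (sign_kernel S) (sign_kernel T)"
  shows "\<phi> id = id"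
proof -
  have "\<phi> id \<in> sign_kernel T" using assms by (auto simp: mult_iso_def bij_betw_def)
  then have t: "\<phi> id \<in> tree_auts" by (rule sign_kernel_tree_auts)
  have "\<phi> (id \<circ> id) = \<phi> id \<circ> \<phi> id"
    using assms id_sign_kernel unfolding mult_iso_def by blast
  then have "\<phi> id (\<phi> id x) = \<phi> id x" for x by (metis comp_apply comp_id)
  then show ?thesis using tree_auts_eq_iff[OF t] by auto
qed

lemma mult_iso_centralizing_pair:
  assumes iso: "mult_iso \<phi> (sign_kernel S) (sign_kernel T)"
    and cp: "centralizing_pair (sign_kernel S) A B"
  shows "centralizing_pair (sign_kernel T) (\<phi> ` A) (\<phi> ` B)"
proof -
  have sub: "A \<subseteq> sign_kernel S" "B \<subseteq> sign_kernel S"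
    using centralizing_pair_subset cp centralizing_pair_commute by blast+
  have "cent (sign_kernel S) B = A" "cent (sign_kernel S) A = B" "A \<noteq> {id}" "B \<noteq> {id}"
    using cp unfolding centralizing_pair_def by blast+
  then have "cent (sign_kernel T) (\<phi> ` B) = \<phi> ` A" "cent (sign_kernel T) (\<phi> ` A) = \<phi> ` B"
    using mult_iso_cent[OF iso comp_sign_kernel] sub by simp_all
  moreover have "\<phi> ` C \<noteq> {id}" if "C \<subseteq> sign_kernel S" "C \<noteq> {id}" for C
  proof
    assume "\<phi> ` C = {id}"
    then have "\<phi> ` C = \<phi> ` {id}" using mult_iso_id[OF iso] by simp
    moreover have "inj_on \<phi> (sign_kernel S)" using iso by (simp add: mult_iso_def bij_betw_def)
    ultimately show False using that inj_on_image_eq_iff[of \<phi> "sign_kernel S" C "{id}"] by simp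
  qed
  ultimately show ?thesis
    using sub \<open>A \<noteq> {id}\<close> \<open>B \<noteq> {id}\<close> unfolding centralizing_pair_def by blast
qed

lemma mult_iso_pair_conjugates:
  assumes iso: "mult_iso \<phi> (sign_kernel S) (sign_kernel T)"
    and cp: "centralizing_pair (sign_kernel S) A B" and "h \<in> sign_kernel S"
    and "C \<in> {A, B}" "D \<in> {A, B}"
  shows "conjugates (\<phi> h) (\<phi> ` C) (\<phi> ` D) \<longleftrightarrow> conjugates h C D"
proof -
  have "A \<subseteq> sign_kernel S" "B \<subseteq> sign_kernel S"
    using centralizing_pair_subset cp centralizing_pair_commute by blast+
  then show ?thesis using assms by (intro mult_iso_conjugates[OF iso comp_sign_kernel]) auto
qed

lemma mult_iso_permuted_pair:
  assumes iso: "mult_iso \<phi> (sign_kernel S) (sign_kernel T)"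
    and pp: "permuted_pair (sign_kernel S) A B"
  shows "permuted_pair (sign_kernel T) (\<phi> ` A) (\<phi> ` B)"
proof -
  have cp: "centralizing_pair (sign_kernel S) A B" using pp by (simp add: permuted_pair_def)
  have "sign_kernel T = \<phi> ` sign_kernel S" using iso by (simp add: mult_iso_def bij_betw_def)
  then show ?thesis
    using pp mult_iso_centralizing_pair[OF iso cp] mult_iso_pair_conjugates[OF iso cp]
    unfolding permuted_pair_def by auto
qed

lemma mult_iso_normal_pair:
  assumes iso: "mult_iso \<phi> (sign_kernel S) (sign_kernel T)"
    and np: "normal_pair (sign_kernel S) A B"
  shows "normal_pair (sign_kernel T) (\<phi> ` A) (\<phi> ` B)"
proof -
  have cp: "centralizing_pair (sign_kernel S) A B" using np by (simp add: normal_pair_def)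
  have "sign_kernel T = \<phi> ` sign_kernel S" using iso by (simp add: mult_iso_def bij_betw_def)
  then show ?thesis
    using np mult_iso_centralizing_pair[OF iso cp] mult_iso_pair_conjugates[OF iso cp]
    unfolding normal_pair_def by auto
qed

lemma mult_iso_graft:
  assumes "finite S"
  shows "mult_iso (graft [i]) (sign_kernel {k. Suc k \<in> S}) (half S i)"
proof -
  have "inj_on (graft [i]) (sign_kernel {k. Suc k \<in> S})"
    by (rule inj_onI) (simp add: graft_eq_iff)
  then show ?thesis
    using half_eq_graft[OF assms, of i] by (simp add: mult_iso_def bij_betw_def graft_comp)
qed

text \<open>The image of the halves for \<open>S\<close> is a permuted pair for \<open>T\<close>,
  hence consists of the halves for \<open>T\<close>. Grafting turns the restriction of the
  isomorphism into one of shifted kernels, and the involution criterion transports level 0.\<close>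

lemma sign_kernel_iso_step:
  assumes fin: "finite S" "finite T" and T: "T \<noteq> {0}" "T \<noteq> {1}"
    and iso: "mult_iso \<phi> (sign_kernel S) (sign_kernel T)"
  shows "\<exists>\<psi>. mult_iso \<psi> (sign_kernel {k. Suc k \<in> S}) (sign_kernel {k. Suc k \<in> T})"
    and "0 \<in> S \<longleftrightarrow> 0 \<in> T"
proof -
  have pp: "permuted_pair (sign_kernel S) (half S True) (half S (\<not> True))"
    by (rule permuted_pair_half[OF fin(1)])
  then have cp: "centralizing_pair (sign_kernel S) (half S True) (half S (\<not> True))"
    by (simp add: permuted_pair_def)
  obtain i where i: "\<phi> ` half S True = half T i" "\<phi> ` half S (\<not> True) = half T (\<not> i)"
    using permuted_pair_eq_halves[OF fin(2) T mult_iso_permuted_pair[OF iso pp]] by metis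
  have "mult_iso \<phi> (half S True) (half T i)"
    using iso i(1) half_subset[of S True] unfolding mult_iso_def
    by (metis bij_betw_subset subsetD)
  moreover have "mult_iso (inv_into (sign_kernel {k. Suc k \<in> T}) (graft [i])) (half T i)
      (sign_kernel {k. Suc k \<in> T})"
    by (rule mult_iso_inv[OF mult_iso_graft[OF fin(2)] comp_sign_kernel])
  ultimately show "\<exists>\<psi>. mult_iso \<psi> (sign_kernel {k. Suc k \<in> S}) (sign_kernel {k. Suc k \<in> T})"
    using mult_iso_graft[OF fin(1)] mult_iso_comp by blast
  have img: "sign_kernel T = \<phi> ` sign_kernel S" and inj: "inj_on \<phi> (sign_kernel S)"
    using iso by (simp_all add: mult_iso_def bij_betw_def)
  have sq: "\<phi> h \<circ> \<phi> h = id \<longleftrightarrow> h \<circ> h = id" if "h \<in> sign_kernel S" for h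
  proof -
    have "\<phi> h \<circ> \<phi> h = \<phi> (h \<circ> h)" using that iso by (simp add: mult_iso_def)
    then show ?thesis
      using mult_iso_id[OF iso] inj_on_eq_iff[OF inj, of "h \<circ> h" id] that by simp
  qed
  have "(\<exists>h\<in>sign_kernel T. h \<circ> h = id \<and> conjugates h (half T i) (half T (\<not> i))) \<longleftrightarrow>
      (\<exists>h\<in>sign_kernel S. h \<circ> h = id \<and> conjugates h (half S True) (half S (\<not> True)))"
    unfolding img i[symmetric]
    using sq mult_iso_pair_conjugates[OF iso cp, of _ "half S True" "half S (\<not> True)"] by auto
  then show "0 \<in> S \<longleftrightarrow> 0 \<in> T"
    using half_swapping_involution_iff[OF fin(1), of True] half_swapping_involution_iff[OF fin(2), of i]
    by blast
qed

text \<open>Induction on the level bound. The set \<open>{0}\<close> is recognised by its normal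
  pair. Otherwise, unless both sets are \<open>{1}\<close>, the step applies with a set other than
  \<open>{1}\<close> as target, if necessary to the inverse isomorphism.\<close>

lemma sign_kernel_iso_imp_eq:
  assumes "S \<subseteq> {..<n}" "T \<subseteq> {..<n}" "mult_iso \<phi> (sign_kernel S) (sign_kernel T)"
  shows "S = T"
  using assms
proof (induction n arbitrary: S T \<phi>)
  case 0
  then show ?case by simp
next
  case (Suc n)
  have fin: "finite S" "finite T" using Suc.prems finite_subset by blast+
  have zero: "T' = {0}" if "S' = {0}" "finite T'" "mult_iso \<psi> (sign_kernel S') (sign_kernel T')" for S' T' \<psi>
    using mult_iso_normal_pair[OF that(3)] normal_pair_half no_normal_pair[OF that(2)] that(1) by metis
  have step: "S' = T'"
    if "S' \<subseteq> {..<Suc n}" "T' \<subseteq> {..<Suc n}" "T' \<noteq> {0}" "T' \<noteq> {1}"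
      "mult_iso \<psi> (sign_kernel S') (sign_kernel T')" for S' T' \<psi>
  proof -
    note iso' = that(3-5)
    have fin': "finite S'" "finite T'" using that finite_subset by blast+
    obtain \<chi> where "mult_iso \<chi> (sign_kernel {k. Suc k \<in> S'}) (sign_kernel {k. Suc k \<in> T'})"
      using sign_kernel_iso_step(1)[OF fin' iso'] by blast
    moreover have "{k. Suc k \<in> S'} \<subseteq> {..<n}" "{k. Suc k \<in> T'} \<subseteq> {..<n}" using that(1,2) by auto
    ultimately have "{k. Suc k \<in> S'} = {k. Suc k \<in> T'}" using Suc.IH by blast
    then have "Suc k \<in> S' \<longleftrightarrow> Suc k \<in> T'" for k by blast
    moreover have "0 \<in> S' \<longleftrightarrow> 0 \<in> T'" using sign_kernel_iso_step(2)[OF fin' iso'] .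
    ultimately have "k \<in> S' \<longleftrightarrow> k \<in> T'" for k by (cases k) auto
    then show ?thesis by blast
  qed
  have iso': "mult_iso (inv_into (sign_kernel S) \<phi>) (sign_kernel T) (sign_kernel S)"
    by (rule mult_iso_inv[OF Suc.prems(3) comp_sign_kernel])
  show ?case
  proof (cases "S = {0} \<or> T = {0}")
    case True
    then show ?thesis using zero[OF _ fin(2) Suc.prems(3)] zero[OF _ fin(1) iso'] by blast
  next
    case False
    then show ?thesis
      using step[OF Suc.prems(1,2) _ _ Suc.prems(3)] step[OF Suc.prems(2,1) _ _ iso'] by blast
  qed
qed

section \<open>Closed subgroups of index at most two\<close>

lemma carrier_Omega: "carrier Omega = tree_auts"
  by (simp add: Omega_def)

lemma mult_Omega: "g \<otimes>\<^bsub>Omega\<^esub> h = g \<circ> h"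
  by (simp add: Omega_def)

text \<open>A basic open set of the product constrains finitely many truncations, and agreement up
  to a bound on their depths determines all of them.\<close>

lemma openin_Omega_top_nbhd:
  assumes "openin Omega_top U" "g \<in> U"
  obtains n where "\<And>g'. g' \<in> tree_auts \<Longrightarrow> (\<And>w. length w \<le> n \<Longrightarrow> g' w = g w) \<Longrightarrow> g' \<in> U"
proof -
  let ?P = "product_topology (\<lambda>n. discrete_topology (trunc_aut n ` carrier Omega)) UNIV"
  let ?f = "\<lambda>g n. trunc_aut n g"
  obtain V where V: "openin ?P V" "U = ?f -` V \<inter> carrier Omega"
    using assms(1) unfolding Omega_top_def openin_pullback_topology by blast
  have "?f g \<in> V" using assms(2) V(2) by blast
  then obtain X where X: "finite {i. X i \<noteq> trunc_aut i ` carrier Omega}"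
      "\<And>i. trunc_aut i g \<in> X i" "Pi\<^sub>E UNIV X \<subseteq> V"
    using V(1) unfolding openin_product_topology_alt by (fastforce simp: PiE_iff)
  have "\<exists>n. \<forall>i\<in>{i. X i \<noteq> trunc_aut i ` carrier Omega}. i < n"
    using X(1) by (simp only: finite_nat_set_iff_bounded)
  then obtain n where n: "\<And>i. X i \<noteq> trunc_aut i ` carrier Omega \<Longrightarrow> i < n" by blast
  have "g' \<in> U" if g': "g' \<in> tree_auts" "\<And>w. length w \<le> n \<Longrightarrow> g' w = g w" for g'
  proof -
    have "trunc_aut i g' \<in> X i" for i
    proof (cases "i < n")
      case True
      then have "trunc_aut i g' = trunc_aut i g"
        using g'(2) by (auto simp: trunc_aut_def trunc_tree_def restrict_def)
      then show ?thesis using X(2) by simp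
    next
      case False
      then have "X i = trunc_aut i ` carrier Omega" using n by blast
      then show ?thesis using g'(1) by (simp add: carrier_Omega)
    qed
    then have "?f g' \<in> V" using X(3) by (auto simp: PiE_iff)
    then show ?thesis using V(2) g'(1) by (simp add: carrier_Omega)
  qed
  then show thesis using that by blast
qed

text \<open>Otherwise \<open>H\<close> and the cosets of the inverse of \<open>h\<close> and of
  \<open>g\<close> would be three distinct cosets.\<close>

lemma index_at_most_two_mult:
  assumes "subgroup H Omega" "index_at_most Omega H 2"
    and g: "g \<in> tree_auts" "g \<notin> H" and h: "h \<in> tree_auts" "h \<notin> H"
  shows "g \<circ> h \<in> H"
proof (rule ccontr)
  assume gh: "g \<circ> h \<notin> H"
  interpret group Omega by (rule group_Omega)
  interpret H: subgroup H Omega by fact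
  have gc: "g \<in> carrier Omega" "h \<in> carrier Omega" using g h by (simp_all add: carrier_Omega)
  have in_coset: "x \<in> H" if "H #>\<^bsub>Omega\<^esub> x = H" "x \<in> carrier Omega" for x
    using that rcos_self[OF that(2) assms(1)] by simp
  let ?C = "{H, H #>\<^bsub>Omega\<^esub> inv\<^bsub>Omega\<^esub> h, H #>\<^bsub>Omega\<^esub> g}"
  have "H #>\<^bsub>Omega\<^esub> inv\<^bsub>Omega\<^esub> h \<noteq> H"
    using in_coset[of "inv\<^bsub>Omega\<^esub> h"] H.m_inv_closed[of "inv\<^bsub>Omega\<^esub> h"] gc h(2) by auto
  moreover have "H #>\<^bsub>Omega\<^esub> g \<noteq> H" using in_coset gc g(2) by blast
  moreover have "H #>\<^bsub>Omega\<^esub> inv\<^bsub>Omega\<^esub> h \<noteq> H #>\<^bsub>Omega\<^esub> g"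
  proof
    assume "H #>\<^bsub>Omega\<^esub> inv\<^bsub>Omega\<^esub> h = H #>\<^bsub>Omega\<^esub> g"
    then have "g \<in> H #>\<^bsub>Omega\<^esub> inv\<^bsub>Omega\<^esub> h" using rcos_self[OF gc(1) assms(1)] by simp
    then obtain k where k: "k \<in> H" "g = k \<otimes>\<^bsub>Omega\<^esub> inv\<^bsub>Omega\<^esub> h" by (auto simp: r_coset_def)
    have "k \<in> carrier Omega" using k(1) by simp
    then have "g \<otimes>\<^bsub>Omega\<^esub> h = k" using k(2) gc by (simp add: m_assoc)
    then show False using gh k(1) by (simp add: mult_Omega)
  qed
  ultimately have "card ?C = 3" by auto
  moreover have "?C \<subseteq> rcosets\<^bsub>Omega\<^esub> H"
    using gc assms(1) H.subset coset_mult_one[OF H.subset] one_closed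
    by (auto simp: RCOSETS_def intro: bexI[of _ "\<one>\<^bsub>Omega\<^esub>"])
  then have "card ?C \<le> card (rcosets\<^bsub>Omega\<^esub> H)"
    using assms(2) by (intro card_mono) (auto simp: index_at_most_def)
  ultimately show False using assms(2) by (simp add: index_at_most_def)
qed

definition level_stab :: "nat \<Rightarrow> (bool list \<Rightarrow> bool list) set" where
  "level_stab n = {g \<in> tree_auts. \<forall>w. length w \<le> n \<longrightarrow> g w = w}"

text \<open>The open complement contains, with some \<open>g\<close>, everything agreeing with
  \<open>g\<close> up to level \<open>n\<close>. For \<open>x\<close> in the stabiliser but outside
  \<open>H\<close>, the index bound puts \<open>g \<circ> x\<close> into \<open>H\<close>, although
  it agrees with \<open>g\<close> there.\<close>

lemma closed_index_two_contains_level_stab: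
  assumes H: "subgroup H Omega" "closedin Omega_top H" "index_at_most Omega H 2"
  obtains n where "level_stab n \<subseteq> H"
proof (cases "H = tree_auts")
  case True
  then show thesis using that by (auto simp: level_stab_def)
next
  case False
  have sub: "H \<subseteq> tree_auts" using subgroup.subset[OF H(1)] by (simp add: carrier_Omega)
  then obtain g where g: "g \<in> tree_auts" "g \<notin> H" using False by blast
  have "openin Omega_top (tree_auts - H)"
    using H(2) by (simp add: closedin_def topspace_Omega_top carrier_Omega)
  then obtain n where n: "\<And>g'. g' \<in> tree_auts \<Longrightarrow> (\<And>w. length w \<le> n \<Longrightarrow> g' w = g w) \<Longrightarrow> g' \<in> tree_auts - H"
    using openin_Omega_top_nbhd[of "tree_auts - H" g] g by blast
  have "x \<in> H" if "x \<in> level_stab n" for x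
  proof (rule ccontr)
    assume "x \<notin> H"
    have x: "x \<in> tree_auts" "\<And>w. length w \<le> n \<Longrightarrow> x w = w" using that by (auto simp: level_stab_def)
    then have "g \<circ> x \<in> H" using index_at_most_two_mult[OF H(1,3) g] \<open>x \<notin> H\<close> by blast
    then show False using n[of "g \<circ> x"] g x by simp
  qed
  then show thesis using that by blast
qed

lemma level_stab_flips:
  assumes "g \<in> tree_auts"
  shows "g \<in> level_stab n \<longleftrightarrow> (\<forall>w. length w < n \<longrightarrow> \<not> flips g w)"
proof
  assume "g \<in> level_stab n"
  then show "\<forall>w. length w < n \<longrightarrow> \<not> flips g w" by (auto simp: level_stab_def flips_def)
next
  assume *: "\<forall>w. length w < n \<longrightarrow> \<not> flips g w"
  have "g w = w" if "length w \<le> n" for w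
    using that by (induction w) (use assms * in \<open>auto simp: tree_auts_Cons\<close>)
  then show "g \<in> level_stab n" using assms by (simp add: level_stab_def)
qed

text \<open>Modulo the level stabiliser, an automorphism is a product of elementary swaps.\<close>

lemma multiplicative_eq_on_tree_auts:
  fixes \<chi> \<chi>' :: "(bool list \<Rightarrow> bool list) \<Rightarrow> int"
  assumes mult: "\<And>g h. g \<in> tree_auts \<Longrightarrow> h \<in> tree_auts \<Longrightarrow> \<chi> (g \<circ> h) = \<chi> g * \<chi> h"
      "\<And>g h. g \<in> tree_auts \<Longrightarrow> h \<in> tree_auts \<Longrightarrow> \<chi>' (g \<circ> h) = \<chi>' g * \<chi>' h"
    and stab: "\<And>g. g \<in> level_stab n \<Longrightarrow> \<chi> g = \<chi>' g"
    and swap: "\<And>u. \<chi> (swap_at u) = \<chi>' (swap_at u)" "\<And>u. \<chi>' (swap_at u) \<noteq> 0"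
    and "g \<in> tree_auts"
  shows "\<chi> g = \<chi>' g"
proof -
  have "\<forall>g\<in>level_stab m. \<chi> g = \<chi>' g" if "m \<le> n" for m
    using that
  \<comment> \<open>Descending from \<open>n\<close> to 0; within a level, the number of flips on
    that level decreases.\<close>
  proof (induction rule: inc_induct)
    case base
    then show ?case using stab by blast
  next
    case (step m)
    have "\<chi> g = \<chi>' g" if "g \<in> level_stab m" for g
      using that
    proof (induction "card {u. length u = m \<and> flips g u}" arbitrary: g rule: less_induct)
      case less
      have g: "g \<in> tree_auts" using less.prems by (simp add: level_stab_def)
      have fin: "finite {u. length u = m \<and> flips g u}"
        by (rule rev_finite_subset[OF finite_level_words[of "{m}"]]) auto
      show ?case
      proof (cases "\<exists>u. length u = m \<and> flips g u")
        case False
        then have "g \<in> level_stab (Suc m)"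
          using less.prems g by (auto simp: level_stab_flips less_Suc_eq)
        then show ?thesis using step.IH by blast
      next
        case True
        then obtain u where u: "length u = m" "flips g u" by blast
        \<comment> \<open>Composition with the swap toggles the flip at \<open>u\<close> and changes
          nothing else on levels up to \<open>m\<close>.\<close>
        have fl: "flips (g \<circ> swap_at u) w \<longleftrightarrow> (w = u) \<noteq> flips g w" if "length w \<le> m" for w
          using that g u(1) by (simp add: flips_comp swap_at_fixes_length)
        have "g \<circ> swap_at u \<in> level_stab m"
          using less.prems g u by (auto simp: level_stab_flips fl)
        moreover have "{w. length w = m \<and> flips (g \<circ> swap_at u) w} \<subset> {w. length w = m \<and> flips g w}"
          using u fl by auto
        then have "card {w. length w = m \<and> flips (g \<circ> swap_at u) w} < card {w. length w = m \<and> flips g w}"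
          using fin by (rule psubset_card_mono[rotated])
        ultimately have "\<chi> (g \<circ> swap_at u) = \<chi>' (g \<circ> swap_at u)" using less.hyps by blast
        then show ?thesis using mult[OF g swap_at_tree_auts] swap by simp
      qed
    qed
    then show ?case by blast
  qed
  from this[of 0] show ?thesis using assms(6) by (auto simp: level_stab_def)
qed

text \<open>Membership in \<open>H\<close>, read as a sign, is multiplicative by the index bound.
  Swaps on one level are conjugate and share this sign, so it agrees with a level sign on swaps and
  on a level stabiliser, hence everywhere.\<close>

lemma closed_index_two_eq_sign_kernel:
  assumes H: "subgroup H Omega" "closedin Omega_top H" "index_at_most Omega H 2"
  obtains S where "finite S" "H = sign_kernel S"
proof -
  obtain n where n: "level_stab n \<subseteq> H" using closed_index_two_contains_level_stab[OF H] by blast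
  have sub: "H \<subseteq> tree_auts" using subgroup.subset[OF H(1)] by (simp add: carrier_Omega)
  have closed: "g \<circ> h \<in> H" if "g \<in> H" "h \<in> H" for g h
    using subgroup.m_closed[OF H(1) that] by (simp add: mult_Omega)
  have inv_closed: "finv g \<in> H" if "g \<in> H" for g
  proof -
    interpret group Omega by (rule group_Omega)
    have g: "g \<in> tree_auts" using that sub by blast
    have "inv\<^bsub>Omega\<^esub> g = finv g"
      by (rule inv_equality) (use g in \<open>simp_all add: carrier_Omega mult_Omega, simp add: Omega_def\<close>)
    then show ?thesis using subgroup.m_inv_closed[OF H(1) that] by simp
  qed
  define \<chi> :: "(bool list \<Rightarrow> bool list) \<Rightarrow> int" where "\<chi> g = (if g \<in> H then 1 else -1)" for g
  have mult: "\<chi> (g \<circ> h) = \<chi> g * \<chi> h" if gh: "g \<in> tree_auts" "h \<in> tree_auts" for g h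
  proof -
    have "h \<in> H" if "g \<in> H" "g \<circ> h \<in> H"
    proof -
      have "h = finv g \<circ> (g \<circ> h)" using gh by (simp add: fun_eq_iff)
      then show ?thesis using closed inv_closed that by metis
    qed
    moreover have "g \<in> H" if "h \<in> H" "g \<circ> h \<in> H"
    proof -
      have "g = (g \<circ> h) \<circ> finv h" using gh by (simp add: fun_eq_iff)
      then show ?thesis using closed inv_closed that by metis
    qed
    ultimately have "g \<circ> h \<in> H \<longleftrightarrow> (g \<in> H \<longleftrightarrow> h \<in> H)"
      using closed[of g h] index_at_most_two_mult[OF H(1,3), of g h] gh by blast
    then show ?thesis unfolding \<chi>_def by simp
  qed
  have nz: "\<chi> g \<noteq> 0" for g by (simp add: \<chi>_def)
  have conj: "\<chi> (swap_at u) = \<chi> (swap_at v)" if uv: "length u = length v" for u v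
  proof -
    obtain g where g: "g \<in> tree_auts" "g u = v" "\<And>x. flips g x \<Longrightarrow> length x < length u"
      using tree_auts_transitive[OF uv] by blast
    have "g \<circ> swap_at u = swap_at v \<circ> g" using swap_at_conj[OF g(1,3)] g(2) by simp
    then have "\<chi> g * \<chi> (swap_at u) = \<chi> (swap_at v) * \<chi> g"
      using mult[OF g(1) swap_at_tree_auts] mult[OF swap_at_tree_auts g(1)] by metis
    then show ?thesis using nz[of g] by simp
  qed
  \<comment> \<open>Only levels below \<open>n\<close> can occur, since a swap at level
    \<open>n\<close> or deeper lies in the stabiliser and hence in \<open>H\<close>.\<close>
  define S where "S = {k. k < n \<and> swap_at (replicate k True) \<notin> H}"
  have fin: "finite S" by (simp add: S_def)
  have one: "level_sign S g = 1" if "g \<in> level_stab n" for g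
  proof -
    have "\<not> flips g w" if "length w \<in> S" for w
      using that \<open>g \<in> level_stab n\<close> level_stab_flips[of g n] by (auto simp: S_def level_stab_def)
    then show ?thesis by (simp add: level_sign_def act_sign_def)
  qed
  have "\<chi> g = level_sign S g" if "g \<in> tree_auts" for g
  proof (rule multiplicative_eq_on_tree_auts[where \<chi> = \<chi> and \<chi>' = "level_sign S" and n = n])
    show "\<chi> (swap_at u) = level_sign S (swap_at u)" for u
    proof (cases "length u < n")
      case True
      then show ?thesis
        using conj[of u "replicate (length u) True"] fin
        by (simp add: level_sign_swap_at S_def \<chi>_def)
    next
      case False
      then have "swap_at u \<in> level_stab n" by (auto simp: level_stab_def swap_at_fixes_length)
      then show ?thesis using one n by (auto simp: \<chi>_def)
    qed
    show "level_sign S (swap_at u) \<noteq> 0" for u using fin by (simp add: level_sign_swap_at)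
    show "\<chi> g = level_sign S g" if "g \<in> level_stab n" for g
      using that one n by (auto simp: \<chi>_def)
  qed (use mult level_sign_comp that in auto)
  then have "g \<in> H \<longleftrightarrow> level_sign S g = 1" if "g \<in> tree_auts" for g
    using that by (metis \<chi>_def one_neq_neg_one)
  then have "H = sign_kernel S" using sub by (auto simp: sign_kernel_def)
  then show thesis using that fin by blast
qed

theorem theoremC:
  fixes H1 H2 :: "(bool list \<Rightarrow> bool list) set"
  assumes "subgroup H1 Omega" and "closedin Omega_top H1" and "index_at_most Omega H1 2"
    and "subgroup H2 Omega" and "closedin Omega_top H2" and "index_at_most Omega H2 2"
  shows "top_group_isomorphic
           (Omega\<lparr>carrier := H1\<rparr>) (subtopology Omega_top H1)
           (Omega\<lparr>carrier := H2\<rparr>) (subtopology Omega_top H2)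
         \<longleftrightarrow> H1 = H2"
proof
  assume "top_group_isomorphic
    (Omega\<lparr>carrier := H1\<rparr>) (subtopology Omega_top H1)
    (Omega\<lparr>carrier := H2\<rparr>) (subtopology Omega_top H2)"
  then obtain \<phi> where "\<phi> \<in> iso (Omega\<lparr>carrier := H1\<rparr>) (Omega\<lparr>carrier := H2\<rparr>)"
    by (auto simp: top_group_isomorphic_def)
  then have iso: "mult_iso \<phi> H1 H2"
    by (simp add: iso_def hom_def mult_iso_def Omega_def)
  obtain S where S: "finite S" "H1 = sign_kernel S"
    using closed_index_two_eq_sign_kernel[OF assms(1-3)] by blast
  obtain T where T: "finite T" "H2 = sign_kernel T"
    using closed_index_two_eq_sign_kernel[OF assms(4-6)] by blast
  have "\<exists>n. \<forall>k\<in>S \<union> T. k < n"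
    using S(1) T(1) by (simp only: finite_nat_set_iff_bounded[symmetric] finite_Un simp_thms)
  then obtain n where "S \<subseteq> {..<n}" "T \<subseteq> {..<n}" by blast
  then have "S = T" using sign_kernel_iso_imp_eq iso S(2) T(2) by blast
  then show "H1 = H2" using S(2) T(2) by simp
next
  assume eq: "H1 = H2"
  have "id \<in> iso (Omega\<lparr>carrier := H2\<rparr>) (Omega\<lparr>carrier := H2\<rparr>)"
    by (simp add: iso_def hom_def Pi_def)
  moreover have "homeomorphic_map (subtopology Omega_top H2) (subtopology Omega_top H2) id"
    by (simp add: homeomorphic_map_id)
  ultimately show "top_group_isomorphic
    (Omega\<lparr>carrier := H1\<rparr>) (subtopology Omega_top H1)
    (Omega\<lparr>carrier := H2\<rparr>) (subtopology Omega_top H2)"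
    unfolding top_group_isomorphic_def eq by blast
qed

end
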